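(* There is a concave function $s:[-\tfrac12,1]\to[-1,1]$ satisfying $$r(x)\le s(x)\le 1-\frac23(1-x)^2\qquad\text{for all }x\in[-\tfrac12,1],$$ such that the exact region determined by Spearman's footrule and Spearman's rho, i.e. the set $\{(\phi(C),\rho(C)) : C\in\mathcal C\}\subseteq[-\tfrac12,1]\times[-1,1]$, is equal to $$\Bigl\{(x,y) : x\in[-\tfrac12,1],\ \frac29\sqrt3\,(1+2x)^{3/2}-1\le y\le s(x)\Bigr\}.$$ Here $r:[-\tfrac12,1]\to[-1,1]$ is the function $$r(x)=\begin{cases}2x+\frac12-\frac{\sqrt3}{9}(1+2x)^{3/2}; & x\in[-\frac12,-\frac18],\\[2pt] \frac43x+\frac7{24}; & x\in[-\frac18,\frac14],\\[2pt] \dfrac{2n+1}{n^2+n}\,x+\dfrac{2n^2-2n+1}{2(n^2+n)}; & x\in\bigl[1-\frac{3}{2n},\,1-\frac{3}{2(n+1)}\bigr],\ n=2,3,\dots,\\[2pt] 1; & x=1.\end{cases}$$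
   Context: Let $\mathbb I=[0,1]$. A bivariate copula is a function $C:\mathbb I^2\to\mathbb I$ with $C(0,v)=C(u,0)=0$, $C(u,1)=u$, $C(1,v)=v$ for all $u,v\in\mathbb I$, and $C(u_2,v_2)-C(u_2,v_1)-C(u_1,v_2)+C(u_1,v_1)\ge 0$ whenever $0\le u_1\le u_2\le 1$, $0\le v_1\le v_2\le 1$. The set of all bivariate copulas is denoted by $\mathcal C$. Spearman's rho is $\rho(C)=12\int_{\mathbb I^2}C(u,v)\,du\,dv-3$ and Spearman's footrule is $\phi(C)=6\int_0^1C(u,u)\,du-2$. *)

theory Defs
  imports "HOL-Analysis.Analysis"
begin

text \<open>
  A copula is represented by a total function on the reals of which only the values on the
  unit square matter; both coefficients below depend on these values only.
\<close>

definition copula :: "(real \<Rightarrow> real \<Rightarrow> real) \<Rightarrow> bool" where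
  "copula C \<longleftrightarrow>
     (\<forall>u\<in>{0..1}. \<forall>v\<in>{0..1}. C u v \<in> {0..1}) \<and>
     (\<forall>v\<in>{0..1}. C 0 v = 0) \<and>
     (\<forall>u\<in>{0..1}. C u 0 = 0) \<and>
     (\<forall>u\<in>{0..1}. C u 1 = u) \<and>
     (\<forall>v\<in>{0..1}. C 1 v = v) \<and>
     (\<forall>u1 u2 v1 v2. 0 \<le> u1 \<and> u1 \<le> u2 \<and> u2 \<le> 1 \<and> 0 \<le> v1 \<and> v1 \<le> v2 \<and> v2 \<le> 1 \<longrightarrow>
        C u2 v2 - C u2 v1 - C u1 v2 + C u1 v1 \<ge> 0)"

definition spearman_rho :: "(real \<Rightarrow> real \<Rightarrow> real) \<Rightarrow> real" where
  "spearman_rho C = 12 * integral ({0..1} \<times> {0..1}) (\<lambda>(u, v). C u v) - 3"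

definition spearman_footrule :: "(real \<Rightarrow> real \<Rightarrow> real) \<Rightarrow> real" where
  "spearman_footrule C = 6 * integral {0..1} (\<lambda>u. C u u) - 2"

definition r_segment :: "nat \<Rightarrow> real set" where
  "r_segment n = {1 - 3 / (2 * real n) .. 1 - 3 / (2 * (real n + 1))}"

definition r_linear :: "nat \<Rightarrow> real \<Rightarrow> real" where
  "r_linear n x = (2 * real n + 1) / (real n ^ 2 + real n) * x
     + (2 * real n ^ 2 - 2 * real n + 1) / (2 * (real n ^ 2 + real n))"

text \<open>
  The closed pieces of the domain of \<open>r_lower\<close> overlap in their end points, where the formulas
  agree; so the choice made there is immaterial (see \<open>r_lower_pieces\<close>). Only the values on
  \<open>{-1/2..1}\<close> are meaningful.
\<close>

definition r_lower :: "real \<Rightarrow> real" where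
  "r_lower x =
     (if x \<le> - 1/8 then 2 * x + 1/2 - sqrt 3 / 9 * (1 + 2 * x) powr (3/2)
      else if x \<le> 1/4 then 4/3 * x + 7/24
      else if x < 1 then r_linear (LEAST n. 2 \<le> n \<and> x \<in> r_segment n) x
      else 1)"

lemma r_linear_agree:
  assumes "2 \<le> m" "2 \<le> n" "x \<in> r_segment m" "x \<in> r_segment n" "m \<le> n"
  shows "r_linear m x = r_linear n x"
proof (cases "m = n")
  case False
  with assms have mn: "m + 1 \<le> n" by simp
  have "3 / (2 * (real m + 1)) \<le> 3 / (2 * real n)"
    using assms by (auto simp: r_segment_def)
  then have "2 * real n \<le> 2 * (real m + 1)"
    using assms by (simp add: field_simps)
  with mn have n: "n = m + 1" by simp
  have pos: "real m > 0" using assms by simp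
  have x: "x = 1 - 3 / (2 * (real m + 1))"
    using assms n by (auto simp: r_segment_def add.commute)
  have "real m ^ 2 + real m \<noteq> 0" "(real m + 1) ^ 2 + (real m + 1) \<noteq> 0" "real m + 1 \<noteq> 0"
    using pos by (smt (verit) zero_le_power2)+
  then show ?thesis
    unfolding r_linear_def n x
    by (simp add: divide_simps) (simp add: algebra_simps power2_eq_square)
qed simp

lemma r_segment_exists:
  assumes "1/4 \<le> x" "x < 1"
  shows "\<exists>n\<ge>2. x \<in> r_segment n"
proof -
  define y where "y = 3 / (2 * (1 - x))"
  define n where "n = nat \<lfloor>y\<rfloor>"
  have "2 \<le> y" using assms by (simp add: y_def field_simps)
  then have n: "2 \<le> n" "real n \<le> y" "y < real n + 1"
    by (simp_all add: n_def le_nat_floor)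
  then have "x \<in> r_segment n"
    using assms by (auto simp: r_segment_def y_def field_simps)
  with n show ?thesis by blast
qed

lemma r_lower_pieces:
  shows "x \<in> {- 1/2 .. - 1/8} \<Longrightarrow> r_lower x = 2 * x + 1/2 - sqrt 3 / 9 * (1 + 2 * x) powr (3/2)"
    and "x \<in> {- 1/8 .. 1/4} \<Longrightarrow> r_lower x = 4/3 * x + 7/24"
    and "2 \<le> n \<Longrightarrow> x \<in> {1 - 3 / (2 * real n) .. 1 - 3 / (2 * (real n + 1))} \<Longrightarrow>
      r_lower x = (2 * real n + 1) / (real n ^ 2 + real n) * x
        + (2 * real n ^ 2 - 2 * real n + 1) / (2 * (real n ^ 2 + real n))"
    and "r_lower 1 = 1"
proof -
  have p: "(3/4::real) powr (3/2) = 3 * sqrt 3 / 8"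
  proof -
    have "(3/4::real) powr (3/2) = (3/4) powr (1 + 1/2)" by simp
    also have "\<dots> = 3/4 * sqrt (3/4)" by (subst powr_add) (simp add: powr_half_sqrt)
    also have "\<dots> = 3 * sqrt 3 / 8" by (simp add: real_sqrt_divide)
    finally show ?thesis .
  qed
  show "r_lower x = 2 * x + 1/2 - sqrt 3 / 9 * (1 + 2 * x) powr (3/2)" if "x \<in> {- 1/2 .. - 1/8}"
    using that by (simp add: r_lower_def)
  show "r_lower x = 4/3 * x + 7/24" if "x \<in> {- 1/8 .. 1/4}"
    using that by (cases "x = - 1/8") (simp_all add: r_lower_def p)
  show "r_lower 1 = 1" by (simp add: r_lower_def)
  show "r_lower x = (2 * real n + 1) / (real n ^ 2 + real n) * x
        + (2 * real n ^ 2 - 2 * real n + 1) / (2 * (real n ^ 2 + real n))"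
    if n: "2 \<le> n" and x: "x \<in> {1 - 3 / (2 * real n) .. 1 - 3 / (2 * (real n + 1))}"
  proof -
    have xs: "x \<in> r_segment n" using x by (simp add: r_segment_def)
    have "3 / (2 * real n) \<le> 3/4" using n by (simp add: field_simps)
    then have lo: "1/4 \<le> x" using x by simp
    have "3 / (2 * (real n + 1)) > 0" by simp
    then have hi: "x < 1" using x by (smt (verit) atLeastAtMost_iff)
    have "r_lower x = r_linear n x"
    proof (cases "x = 1/4")
      case True
      have "x \<in> r_segment 2" using True by (simp add: r_segment_def)
      then have "r_linear 2 x = r_linear n x" using r_linear_agree[of 2 n x] n xs by simp
      moreover have "r_linear 2 x = r_lower x" using True by (simp add: r_lower_def r_linear_def)
      ultimately show ?thesis by simp
    next
      case False
      define m where "m = (LEAST n. 2 \<le> n \<and> x \<in> r_segment n)"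
      have m: "2 \<le> m \<and> x \<in> r_segment m" unfolding m_def using n xs by (intro LeastI) auto
      have "m \<le> n" unfolding m_def using n xs by (intro Least_le) auto
      with m n xs have "r_linear m x = r_linear n x" by (intro r_linear_agree) auto
      then show ?thesis using False lo hi by (simp add: r_lower_def m_def)
    qed
    then show ?thesis by (simp add: r_linear_def)
  qed
qed

end

theory Submission
  imports Defs "HOL-Complex_Analysis.Great_Picard"
begin

text \<open>
  Let \<open>(U, V)\<close> have distribution function \<open>C\<close>.  Then the footrule is \<open>1 - 3 E\<bar>U - V\<bar>\<close> and Spearman's rho
  is \<open>1 - 6 E (U - V)\<^sup>2\<close>, so both coefficients depend only on the difference \<open>V - U\<close>.  Its distribution is
  encoded in the integrals \<open>slice C h\<close> of \<open>C\<close> along the lines \<open>v = u + h\<close>, which equal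
  \<open>1/2 - E max 0 (V - U - h)\<close> for \<open>h \<ge> 0\<close>.  The footrule is given by \<open>slice C 0\<close>, and rho by the integral
  of \<open>slice C h\<close> over \<open>h\<close> (\<open>double_integral_slices\<close>).  With these slices every estimate is an integral of the
  rectangle inequality of copulas, and no measure has to be built from \<open>C\<close>.

  \<^emph>\<open>Upper bound.\<close>  The squares with corners \<open>(t, t)\<close> and \<open>(t + h, t + h)\<close> have nonnegative mass; integrating
  over \<open>t\<close> bounds \<open>slice C h\<close> plus the corresponding slice of the reflected copula by \<open>2 * slice C 0 + h\<close>.
  Integrating this for \<open>h \<le> k\<close> amounts to the inequality \<open>E (\<bar>U - V\<bar> - k)\<^sup>2 \<ge> 0\<close>, and the best \<open>k\<close> is
  \<open>E\<bar>U - V\<bar>\<close>.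

  \<^emph>\<open>Lower bound.\<close>  For \<open>0 \<le> h \<le> a\<close> the rectangles with side intervals \<open>[t, t + h]\<close> and \<open>[t + h, t + a]\<close> give
  \<open>slice C 0 + slice C a \<le> slice C h + slice C (a - h)\<close>.  Integrating over \<open>h\<close>, and estimating \<open>slice C h\<close> for
  \<open>h \<ge> a\<close> by the slice of the smallest copula \<open>max 0 (u + v - 1)\<close>, bounds rho from below by an affine function
  of the footrule for every \<open>a\<close>.  The envelope of these lines is the lower curve.  It is attained by the
  copula that is comonotone on a central square of side \<open>a\<close> and countermonotone outside of it.

  \<^emph>\<open>The region.\<close>  Mixtures of copulas are copulas and both coefficients are affine, so the set of values of
  rho for a fixed footrule is an interval whose upper end \<open>max_rho\<close> is a concave function.  The upper end is
  attained because copulas are equicontinuous, so that the Arzela-Ascoli theorem applies.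

  \<^emph>\<open>The function \<open>r_lower\<close>.\<close>  Among the symmetric copulas with diagonal section \<open>t - T t\<close> the largest
  is \<open>diagonal_copula T\<close>.  For the distance \<open>T\<close> to the multiples of \<open>1/n\<close> it lies on the upper bound, at
  the footrule \<open>1 - 3/(2n)\<close>; for a trapezoid \<open>T\<close> it lies on the curved part of \<open>r_lower\<close>.  The straight parts
  are chords between such points and lie below the graph of the concave function \<open>max_rho\<close>.
\<close>

section \<open>Copulas on the whole plane\<close>

definition clip :: "real \<Rightarrow> real" where
  "clip x = max 0 (min 1 x)"

text \<open>
  The distribution function on the whole plane of the distribution given by \<open>C\<close> on the unit square.
  It lets the integration variable run past the square, so that slices can be shifted freely.
\<close>

definition plane_ext :: "(real \<Rightarrow> real \<Rightarrow> real) \<Rightarrow> real \<Rightarrow> real \<Rightarrow> real" where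
  "plane_ext C u v = C (clip u) (clip v)"

text \<open>
  Input only, because the right-hand side matches every binary function when terms are printed.
\<close>

abbreviation (input) flipped :: "(real \<Rightarrow> real \<Rightarrow> real) \<Rightarrow> real \<Rightarrow> real \<Rightarrow> real" where
  "flipped C \<equiv> \<lambda>u v. C v u"

lemma clip_range: "0 \<le> clip x" "clip x \<le> 1"
  by (auto simp: clip_def)

lemma clip_mono: "x \<le> y \<Longrightarrow> clip x \<le> clip y"
  by (auto simp: clip_def)

lemma clip_id [simp]: "0 \<le> x \<Longrightarrow> x \<le> 1 \<Longrightarrow> clip x = x"
  by (auto simp: clip_def)

lemma clip_0 [simp]: "x \<le> 0 \<Longrightarrow> clip x = 0"
  by (auto simp: clip_def)

lemma clip_1 [simp]: "1 \<le> x \<Longrightarrow> clip x = 1"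
  by (auto simp: clip_def)

lemma clip_increment: "x \<le> y \<Longrightarrow> clip y - clip x \<le> y - x"
  unfolding clip_def max_def min_def by auto

lemma plane_ext_inside: "0 \<le> u \<Longrightarrow> u \<le> 1 \<Longrightarrow> 0 \<le> v \<Longrightarrow> v \<le> 1 \<Longrightarrow> plane_ext C u v = C u v"
  by (simp add: plane_ext_def)

lemma plane_ext_flipped: "plane_ext (flipped C) u v = plane_ext C v u"
  by (simp add: plane_ext_def)

lemma copula_flipped:
  assumes "copula C"
  shows "copula (flipped C)"
proof -
  have "C u2 v2 - C u1 v2 - C u2 v1 + C u1 v1 \<ge> 0"
    if "0 \<le> u1 \<and> u1 \<le> u2 \<and> u2 \<le> 1 \<and> 0 \<le> v1 \<and> v1 \<le> v2 \<and> v2 \<le> 1" for u1 u2 v1 v2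
  proof -
    have "C u2 v2 - C u2 v1 - C u1 v2 + C u1 v1 \<ge> 0"
      using assms that unfolding copula_def by blast
    then show ?thesis by linarith
  qed
  then show ?thesis
    using assms unfolding copula_def by auto
qed

context
  fixes C assumes C: "copula C"
begin

text \<open>
  Clipping is monotone, hence maps a rectangle to a rectangle inside the unit square.
\<close>

lemma plane_ext_rectangle:
  assumes "u1 \<le> u2" "v1 \<le> v2"
  shows "plane_ext C u1 v2 + plane_ext C u2 v1 \<le> plane_ext C u2 v2 + plane_ext C u1 v1"
proof -
  have "0 \<le> clip u1 \<and> clip u1 \<le> clip u2 \<and> clip u2 \<le> 1 \<and> 0 \<le> clip v1 \<and> clip v1 \<le> clip v2 \<and> clip v2 \<le> 1"
    using assms clip_mono clip_range by auto
  then have "C (clip u2) (clip v2) - C (clip u2) (clip v1) - C (clip u1) (clip v2) + C (clip u1) (clip v1) \<ge> 0"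
    using C unfolding copula_def by blast
  then show ?thesis
    by (simp add: plane_ext_def)
qed

lemma plane_ext_boundary:
  shows "u \<le> 0 \<Longrightarrow> plane_ext C u v = 0" "v \<le> 0 \<Longrightarrow> plane_ext C u v = 0"
    "1 \<le> u \<Longrightarrow> plane_ext C u v = clip v" "1 \<le> v \<Longrightarrow> plane_ext C u v = clip u"
  using C clip_range unfolding copula_def plane_ext_def by auto

text \<open>
  Apply the rectangle inequality to a strip that reaches to a boundary line, where the copula is known.
\<close>

lemma plane_ext_increment:
  assumes "u1 \<le> u2"
  shows "plane_ext C u1 v \<le> plane_ext C u2 v" "plane_ext C u2 v - plane_ext C u1 v \<le> clip u2 - clip u1"
    "plane_ext C v u1 \<le> plane_ext C v u2" "plane_ext C v u2 - plane_ext C v u1 \<le> clip u2 - clip u1"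
proof -
  have *: "plane_ext C u 0 = 0" "plane_ext C 0 u = 0" "plane_ext C u (max 1 v) = clip u" "plane_ext C (max 1 v) u = clip u" for u
    by (auto simp: plane_ext_boundary)
  show "plane_ext C u1 v \<le> plane_ext C u2 v"
    using plane_ext_rectangle[of u1 u2 "min 0 v" v] assms by (simp add: plane_ext_boundary)
  show "plane_ext C u2 v - plane_ext C u1 v \<le> clip u2 - clip u1"
    using plane_ext_rectangle[of u1 u2 v "max 1 v"] assms * by simp
  show "plane_ext C v u1 \<le> plane_ext C v u2"
    using plane_ext_rectangle[of "min 0 v" v u1 u2] assms by (simp add: plane_ext_boundary)
  show "plane_ext C v u2 - plane_ext C v u1 \<le> clip u2 - clip u1"
    using plane_ext_rectangle[of v "max 1 v" u1 u2] assms * by simp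
qed

lemma plane_ext_lipschitz: "\<bar>plane_ext C u1 v1 - plane_ext C u2 v2\<bar> \<le> \<bar>u1 - u2\<bar> + \<bar>v1 - v2\<bar>"
proof -
  have 1: "\<bar>plane_ext C a v - plane_ext C b v\<bar> \<le> b - a" "\<bar>plane_ext C v a - plane_ext C v b\<bar> \<le> b - a" if "a \<le> b" for a b v
    using plane_ext_increment[OF that, of v] clip_increment[OF that] by simp_all
  have "\<bar>plane_ext C u1 v1 - plane_ext C u2 v1\<bar> \<le> \<bar>u1 - u2\<bar>"
    using 1(1)[of u1 u2 v1] 1(1)[of u2 u1 v1] by (cases "u1 \<le> u2") (simp_all add: abs_minus_commute)
  moreover have "\<bar>plane_ext C u2 v1 - plane_ext C u2 v2\<bar> \<le> \<bar>v1 - v2\<bar>"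
    using 1(2)[of v1 v2 u2] 1(2)[of v2 v1 u2] by (cases "v1 \<le> v2") (simp_all add: abs_minus_commute)
  ultimately show ?thesis by simp
qed

lemma plane_ext_bounds: "0 \<le> plane_ext C u v" "clip u + clip v - 1 \<le> plane_ext C u v" "plane_ext C u v \<le> clip u" "plane_ext C u v \<le> clip v"
proof -
  have *: "plane_ext C (min 0 u) v = 0" "plane_ext C u (min 0 v) = 0" "plane_ext C (max 1 u) v = clip v" "plane_ext C u (max 1 v) = clip u"
    by (auto simp: plane_ext_boundary)
  show "0 \<le> plane_ext C u v" using plane_ext_increment(1)[of "min 0 u" u v] * by simp
  show "clip u + clip v - 1 \<le> plane_ext C u v" using plane_ext_increment(2)[of u "max 1 u" v] * by simp
  show "plane_ext C u v \<le> clip u" using plane_ext_increment(3)[of v "max 1 v" u] * by simp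
  show "plane_ext C u v \<le> clip v" using plane_ext_increment(1)[of u "max 1 u" v] * by simp
qed

lemma continuous_plane_ext: "continuous_on A (\<lambda>z. plane_ext C (fst z) (snd z))"
proof (rule continuous_onI)
  fix x :: "real \<times> real" and e :: real assume "e > 0"
  have "dist (plane_ext C (fst y) (snd y)) (plane_ext C (fst x) (snd x)) \<le> e" if "dist y x < e/2" for y
  proof -
    have "dist (fst y) (fst x) \<le> dist y x" "dist (snd y) (snd x) \<le> dist y x"
      by (rule dist_fst_le dist_snd_le)+
    then show ?thesis
      using that plane_ext_lipschitz[of "fst y" "snd y" "fst x" "snd x"] by (simp add: dist_real_def)
  qed
  then show "\<exists>d>0. \<forall>x'\<in>A. dist x' x < d \<longrightarrow> dist (plane_ext C (fst x') (snd x')) (plane_ext C (fst x) (snd x)) \<le> e"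
    using \<open>e > 0\<close> by (intro exI[of _ "e/2"]) auto
qed

lemma continuous_plane_ext_compose [continuous_intros]:
  assumes "continuous_on A f" "continuous_on A g"
  shows "continuous_on A (\<lambda>x. plane_ext C (f x) (g x))"
  using continuous_on_compose2[OF continuous_plane_ext[of UNIV] continuous_on_Pair[OF assms]] by simp

end

section \<open>Slices parallel to the diagonal\<close>

definition slice :: "(real \<Rightarrow> real \<Rightarrow> real) \<Rightarrow> real \<Rightarrow> real" where
  "slice C h = integral {0..1} (\<lambda>t. plane_ext C t (t + h))"

lemma integral_shift:
  fixes f :: "real \<Rightarrow> real"
  shows "integral {a..b} (\<lambda>t. f (t + c)) = integral {a+c..b+c} f"
  using integral_shift_Icc_real[of a b f c] by (simp add: o_def add.commute)

lemma integrable_on_Icc: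
  fixes f :: "real \<Rightarrow> real"
  shows "continuous_on UNIV f \<Longrightarrow> f integrable_on {a..b}"
  by (meson continuous_on_subset integrable_continuous_real subset_UNIV)

lemma integral_split:
  fixes f :: "real \<Rightarrow> real"
  assumes "continuous_on UNIV f" "a \<le> c" "c \<le> b"
  shows "integral {a..b} f = integral {a..c} f + integral {c..b} f"
  using Henstock_Kurzweil_Integration.integral_combine[OF assms(2,3) integrable_on_Icc[OF assms(1)]] by simp

lemma integral_by_antiderivative:
  fixes f g :: "real \<Rightarrow> real"
  assumes "a \<le> b"
    and "\<And>x. a \<le> x \<Longrightarrow> x \<le> b \<Longrightarrow> (g has_real_derivative f x) (at x)"
    and "g b - g a = I"
  shows "integral {a..b} f = I"
proof -
  have "(f has_integral (g b - g a)) {a..b}"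
    using assms(1,2)
    by (intro fundamental_theorem_of_calculus)
       (auto simp flip: has_real_derivative_iff_has_vector_derivative intro: has_field_derivative_at_within)
  then show ?thesis using assms(3) by (simp add: integral_unique)
qed

lemma integral_ramp:
  fixes a b c :: real
  assumes "a \<le> c" "c \<le> b"
  shows "integral {a..b} (\<lambda>t. max 0 (t - c)) = (b - c)\<^sup>2 / 2"
proof -
  have "integral {a..b} (\<lambda>t. max 0 (t - c)) = integral {a..c} (\<lambda>t. max 0 (t - c)) + integral {c..b} (\<lambda>t. max 0 (t - c))"
    by (intro integral_split assms continuous_intros)
  moreover have "integral {a..c} (\<lambda>t. max 0 (t - c)) = integral {a..c} (\<lambda>t. 0)"
    by (intro integral_cong) auto
  moreover have "integral {c..b} (\<lambda>t. max 0 (t - c)) = integral {c..b} (\<lambda>t. t - c)"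
    by (intro integral_cong) auto
  moreover have "integral {c..b} (\<lambda>t. t - c) = (b - c)\<^sup>2 / 2"
    by (rule integral_by_antiderivative[OF assms(2), of "\<lambda>t. (t - c)\<^sup>2 / 2"])
       (auto intro!: derivative_eq_intros)
  ultimately show ?thesis by simp
qed

context
  fixes C assumes C: "copula C"
begin

lemma continuous_slice: "continuous_on A (slice C)"
proof -
  have "continuous_on (A \<times> cbox 0 1) (\<lambda>(h, t). plane_ext C t (t + h))"
    unfolding case_prod_beta by (intro continuous_intros C)
  from integral_continuous_on_param[OF this] show ?thesis
    by (simp add: slice_def[abs_def])
qed

lemma integrable_plane_ext: "(\<lambda>t. plane_ext C (t + p) (t + q)) integrable_on {a..b}"
  by (intro integrable_on_Icc continuous_intros C)

text \<open>
  Beyond the unit square the integrand is constant: it is \<open>0\<close> on the left, and on the right it is \<open>1\<close>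
  on an interval of length \<open>p\<close>.  Starting at \<open>-h\<close> makes the interval long enough for all four corners of the
  rectangles used below.
\<close>

lemma slice_shifted:
  assumes "0 \<le> p" "p \<le> q" "q \<le> 1" "p \<le> h" "h \<le> 1"
  shows "integral {-h..1} (\<lambda>t. plane_ext C (t + p) (t + q)) = slice C (q - p) + p"
proof -
  let ?f = "\<lambda>t. plane_ext C t (t + (q - p))"
  have i: "continuous_on UNIV ?f" by (intro continuous_intros C)
  have "integral {-h..1} (\<lambda>t. plane_ext C (t + p) (t + q)) = integral {-h..1} (\<lambda>t. ?f (t + p))"
    by (simp add: algebra_simps)
  also have "\<dots> = integral {-h+p..1+p} ?f" by (rule integral_shift)
  also have "\<dots> = integral {-h+p..0} ?f + (integral {0..1} ?f + integral {1..1+p} ?f)"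
    using assms integral_split[OF i, of "-h+p" 0 "1+p"] integral_split[OF i, of 0 1 "1+p"] by simp
  also have "integral {-h+p..0} ?f = integral {-h+p..0} (\<lambda>t. 0)"
    by (intro integral_cong) (auto simp: plane_ext_boundary C)
  also have "integral {1..1+p} ?f = integral {1..1+p} (\<lambda>t. 1)"
    using assms by (intro integral_cong) (auto simp: plane_ext_boundary C)
  finally show ?thesis using assms by (simp add: slice_def)
qed

text \<open>
  For \<open>t \<ge> 1 - h\<close> the second argument is at least \<open>1\<close>, and the integrand is \<open>t\<close>.
\<close>

lemma slice_tail:
  assumes "0 \<le> h" "h \<le> 1"
  shows "slice C h = integral {0..1-h} (\<lambda>t. C t (t + h)) + (h - h\<^sup>2 / 2)"
proof -
  let ?f = "\<lambda>t. plane_ext C t (t + h)"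
  have i: "continuous_on UNIV ?f" by (intro continuous_intros C)
  have "slice C h = integral {0..1-h} ?f + integral {1-h..1} ?f"
    unfolding slice_def using assms i by (intro integral_split) auto
  also have "integral {0..1-h} ?f = integral {0..1-h} (\<lambda>t. C t (t + h))"
    using assms by (intro integral_cong) (auto simp: plane_ext_inside)
  also have "integral {1-h..1} ?f = integral {1-h..1} (\<lambda>t. t)"
    using assms by (intro integral_cong) (auto simp: plane_ext_boundary C)
  also have "\<dots> = h - h\<^sup>2/2"
    using assms
    by (intro integral_by_antiderivative[of _ _ "\<lambda>t. t\<^sup>2 / 2"])
       (auto intro!: derivative_eq_intros simp: power2_eq_square field_simps)
  finally show ?thesis .
qed

end

context
  fixes C assumes C: "copula C"
begin

text \<open>
  The slices below the diagonal are those of the reflected copula; the correction is the tail from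
  \<open>slice_tail\<close>, which only the slices with \<open>h \<ge> 0\<close> contain.
\<close>

lemma slice_negative:
  assumes "0 \<le> h" "h \<le> 1"
  shows "slice C (- h) = slice (flipped C) h - h + h\<^sup>2 / 2"
proof -
  let ?f = "\<lambda>t. plane_ext C (t + h) t"
  have i: "continuous_on UNIV ?f" by (intro continuous_intros C)
  have "slice C (- h) = integral {-h..1-h} ?f"
    using integral_shift[of "-h" "1-h" "\<lambda>t. plane_ext C t (t - h)" h] by (simp add: slice_def)
  also have "\<dots> = integral {-h..0} ?f + integral {0..1-h} ?f"
    using assms i by (intro integral_split) auto
  also have "integral {-h..0} ?f = integral {-h..0} (\<lambda>t. 0)"
    by (intro integral_cong) (auto simp: plane_ext_boundary C)
  also have "integral {0..1-h} ?f = integral {0..1-h} (\<lambda>t. C (t + h) t)"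
    using assms by (intro integral_cong) (auto simp: plane_ext_inside)
  finally show ?thesis
    using slice_tail[OF copula_flipped[OF C] assms] by simp
qed

text \<open>
  Exchange the order of integration and substitute \<open>v = t + h\<close>: the inner integral runs over
  \<open>[t - 1, t + 1]\<close> and exceeds the one over \<open>[0, 1]\<close> by a piece of length \<open>t\<close> on which the integrand is \<open>t\<close>.
  This accounts for the \<open>1/3\<close>.
\<close>

lemma double_integral_slices:
  "integral ({0..1} \<times> {0..1}) (\<lambda>(u, v). C u v) + 1/3 = integral {-1..1} (slice C)"
proof -
  have i: "continuous_on UNIV (plane_ext C t)" for t
    by (intro continuous_intros C)
  have "integral {-1..1} (slice C) = integral (cbox (-1) 1) (\<lambda>h. integral (cbox 0 1) (\<lambda>t. plane_ext C t (t + h)))"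
    by (simp add: slice_def[abs_def])
  also have "\<dots> = integral (cbox 0 1) (\<lambda>t. integral (cbox (-1) 1) (\<lambda>h. plane_ext C t (t + h)))"
    by (intro integral_swap_continuous) (simp add: case_prod_beta, intro continuous_intros C)
  also have "\<dots> = integral {0..1} (\<lambda>t. integral {0..1} (\<lambda>v. C t v) + t\<^sup>2)"
  proof (simp, intro integral_cong)
    fix t :: real assume t: "t \<in> {0..1}"
    have "integral {-1..1} (\<lambda>h. plane_ext C t (t + h)) = integral {t-1..t+1} (plane_ext C t)"
      using integral_shift[of "-1" 1 "plane_ext C t" t] by (simp add: add.commute)
    also have "\<dots> = integral {t-1..0} (plane_ext C t) + (integral {0..1} (plane_ext C t) + integral {1..t+1} (plane_ext C t))"
      using t integral_split[OF i, of "t-1" 0 "t+1" t] integral_split[OF i, of 0 1 "t+1" t] by simp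
    also have "integral {t-1..0} (plane_ext C t) = integral {t-1..0} (\<lambda>t. 0)"
      by (intro integral_cong) (auto simp: plane_ext_boundary C)
    also have "integral {1..t+1} (plane_ext C t) = integral {1..t+1} (\<lambda>v. t)"
      using t by (intro integral_cong) (auto simp: plane_ext_boundary C)
    also have "integral {0..1} (plane_ext C t) = integral {0..1} (C t)"
      using t by (intro integral_cong) (auto simp: plane_ext_inside)
    finally show "integral {-1..1} (\<lambda>h. plane_ext C t (t + h)) = integral {0..1} (C t) + t\<^sup>2"
      using t by (simp add: power2_eq_square)
  qed
  also have "\<dots> = integral {0..1} (\<lambda>t. integral {0..1} (\<lambda>v. C t v)) + integral {0..1} (\<lambda>t. t\<^sup>2)"
  proof (intro Henstock_Kurzweil_Integration.integral_add)
    have "continuous_on ({0..1} \<times> cbox 0 1) (\<lambda>(t, v). plane_ext C t v)"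
      by (simp add: case_prod_beta) (intro continuous_intros C)
    from integral_continuous_on_param[OF this]
    have "(\<lambda>t. integral {0..1} (plane_ext C t)) integrable_on {0..1}"
      by (simp add: integrable_continuous_real)
    also have "?this \<longleftrightarrow> (\<lambda>t. integral {0..1} (C t)) integrable_on {0..1}"
      by (intro integrable_cong integral_cong) (auto simp: plane_ext_inside)
    finally show "(\<lambda>t. integral {0..1} (C t)) integrable_on {0..1}" .
  qed (intro integrable_on_Icc continuous_intros)
  also have "integral {0..1} (\<lambda>t::real. t\<^sup>2) = 1/3"
    by (rule integral_by_antiderivative[of _ _ "\<lambda>t. t^3 / 3"]) (auto intro!: derivative_eq_intros)
  also have "integral {0..1} (\<lambda>t. integral {0..1} (\<lambda>v. C t v)) = integral {0..1} (\<lambda>t. integral {0..1} (\<lambda>v. plane_ext C t v))"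
    by (intro integral_cong) (auto simp: plane_ext_inside)
  also have "\<dots> = integral ({0..1} \<times> {0..1}) (\<lambda>z. plane_ext C (fst z) (snd z))"
    using integral_prod_continuous[of 0 0 1 1 "\<lambda>z. plane_ext C (fst z) (snd z)"] continuous_plane_ext[OF C]
    by (simp add: cbox_Pair_eq)
  also have "\<dots> = integral ({0..1} \<times> {0..1}) (\<lambda>(u, v). C u v)"
    by (intro integral_cong) (auto simp: plane_ext_inside)
  finally show ?thesis ..
qed

end

lemma double_integral_two_slices:
  assumes C: "copula C"
  shows "integral ({0..1} \<times> {0..1}) (\<lambda>(u, v). C u v) + 2/3
    = integral {0..1} (\<lambda>h. slice C h + slice (flipped C) h)"
proof -
  have int: "slice C integrable_on {a..b}" "slice (flipped C) integrable_on {a..b}" for a b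
    using continuous_slice[OF C] continuous_slice[OF copula_flipped[OF C]]
    by (auto intro: integrable_continuous_real)
  have "integral {-1..1} (slice C) = integral {-1..0} (slice C) + integral {0..1} (slice C)"
    by (intro integral_split continuous_slice C) auto
  also have "integral {-1..0} (slice C) = integral {0..1} (\<lambda>h. slice C (- h))"
    using Henstock_Kurzweil_Integration.integral_reflect_real[of 0 "-1" "slice C"] by simp
  also have "\<dots> = integral {0..1} (\<lambda>h. slice (flipped C) h + (h\<^sup>2 / 2 - h))"
    by (intro integral_cong) (auto simp: slice_negative C)
  also have "\<dots> = integral {0..1} (slice (flipped C)) + integral {0..1} (\<lambda>h. h\<^sup>2 / 2 - h)"
    by (intro Henstock_Kurzweil_Integration.integral_add int integrable_on_Icc continuous_intros) auto
  also have "integral {0..1} (\<lambda>h::real. h\<^sup>2 / 2 - h) = - 1/3"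
    by (rule integral_by_antiderivative[of _ _ "\<lambda>t. t^3 / 6 - t\<^sup>2/2"])
       (auto intro!: derivative_eq_intros simp: power2_eq_square)
  finally have "integral {-1..1} (slice C) =
    integral {0..1} (slice C) + integral {0..1} (slice (flipped C)) - 1/3" by simp
  then show ?thesis
    using double_integral_slices[OF C] int by (simp add: Henstock_Kurzweil_Integration.integral_add)
qed

lemma slice_0: "slice C 0 = integral {0..1} (\<lambda>u. C u u)"
  unfolding slice_def by (intro integral_cong) (auto simp: plane_ext_inside)

lemma integral_id: "(a::real) \<le> b \<Longrightarrow> integral {a..b} (\<lambda>t. t) = (b\<^sup>2 - a\<^sup>2) / 2"
  by (rule integral_by_antiderivative[of _ _ "\<lambda>t. t\<^sup>2 / 2"])
     (auto intro!: derivative_eq_intros simp: field_simps)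

section \<open>Inequalities between slices\<close>

context
  fixes C assumes C: "copula C"
begin

lemma slice_upper: "slice C h \<le> 1/2" if "0 \<le> h"
proof -
  have "slice C h \<le> integral {0..1} (\<lambda>t. t)"
    unfolding slice_def
    using plane_ext_bounds(3)[OF C]
    by (intro integral_le integrable_on_Icc continuous_intros C) (metis atLeastAtMost_iff clip_id)
  then show ?thesis by (simp add: integral_id)
qed

text \<open>
  The bound is the slice of the smallest copula \<open>max 0 (u + v - 1)\<close>.
\<close>

lemma slice_lower: "1/2 - (1 - h)\<^sup>2 / 4 \<le> slice C h" if "0 \<le> h" "h \<le> 1"
proof -
  have "(1 - h)\<^sup>2 / 4 = 2 * integral {0..1-h} (\<lambda>t. max 0 (t - (1-h)/2))"
    using that by (subst integral_ramp) (auto simp: power2_eq_square field_simps)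
  also have "\<dots> = integral {0..1-h} (\<lambda>t. 2 * max 0 (t - (1-h)/2))"
    by simp
  also have "\<dots> \<le> integral {0..1-h} (\<lambda>t. plane_ext C t (t + h))"
  proof (intro integral_le integrable_on_Icc continuous_intros C)
    fix t assume t: "t \<in> {0..1-h}"
    then have "2 * max 0 (t - (1-h)/2) = max 0 (clip t + clip (t + h) - 1)"
      using that by (simp add: max_def field_simps)
    then show "2 * max 0 (t - (1-h)/2) \<le> plane_ext C t (t + h)"
      using plane_ext_bounds(1,2)[OF C, of t "t+h"] by simp
  qed
  also have "\<dots> = integral {0..1-h} (\<lambda>t. C t (t + h))"
    using that by (intro integral_cong) (auto simp: plane_ext_inside)
  finally show ?thesis
    unfolding slice_tail[OF C that] by (simp add: power2_eq_square field_simps)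
qed

text \<open>
  Average the rectangle inequality for the side intervals \<open>[t, t + h]\<close> and \<open>[t + h, t + a]\<close> over \<open>t\<close>.
  The corners of the rectangle lie on the lines with offsets \<open>0\<close>, \<open>a\<close>, \<open>h\<close> and \<open>a - h\<close>.
\<close>

lemma slice_rectangles:
  assumes "0 \<le> h" "h \<le> a" "a \<le> 1"
  shows "slice C 0 + slice C a \<le> slice C h + slice C (a - h)"
proof -
  have i: "(\<lambda>t. plane_ext C (t + p) (t + q)) integrable_on {x..y}" for p q x y
    by (rule integrable_plane_ext[OF C])
  have "integral {-h..1} (\<lambda>t. plane_ext C (t + 0) (t + a) + plane_ext C (t + h) (t + h))
      \<le> integral {-h..1} (\<lambda>t. plane_ext C (t + h) (t + a) + plane_ext C (t + 0) (t + h))"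
    using assms by (intro integral_le integrable_add i plane_ext_rectangle C) auto
  then show ?thesis
    using slice_shifted[OF C, of 0 a h] slice_shifted[OF C, of h h h]
      slice_shifted[OF C, of h a h] slice_shifted[OF C, of 0 h h] assms
    by (simp only: Henstock_Kurzweil_Integration.integral_add i) simp
qed

text \<open>
  Average the rectangle inequality for the square \<open>[t, t + h]\<^sup>2\<close> over \<open>t\<close>; two of its corners lie on the
  diagonal, the others on the lines with offsets \<open>h\<close> and \<open>-h\<close>.
\<close>

lemma slice_squares:
  assumes "0 \<le> h" "h \<le> 1"
  shows "slice C h + slice (flipped C) h \<le> 2 * slice C 0 + h"
proof -
  note C' = copula_flipped[OF C]
  have i: "(\<lambda>t. plane_ext C (t + p) (t + q)) integrable_on {x..y}" for p q x y
    by (rule integrable_plane_ext[OF C])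
  have "integral {-h..1} (\<lambda>t. plane_ext C (t + 0) (t + h) + plane_ext C (t + h) (t + 0))
      \<le> integral {-h..1} (\<lambda>t. plane_ext C (t + h) (t + h) + plane_ext C (t + 0) (t + 0))"
    using assms by (intro integral_le integrable_add i plane_ext_rectangle C) auto
  moreover have "integral {-h..1} (\<lambda>t. plane_ext C (t + h) (t + 0)) = slice (flipped C) h"
    using slice_shifted[OF C', of 0 h h] assms by (simp add: plane_ext_flipped[of C])
  ultimately show ?thesis
    using slice_shifted[OF C, of 0 h h] slice_shifted[OF C, of h h h]
      slice_shifted[OF C, of 0 0 h] assms
    by (simp only: Henstock_Kurzweil_Integration.integral_add i) simp
qed

text \<open>
  On \<open>[0, a]\<close> pair \<open>h\<close> with \<open>a - h\<close> and use \<open>slice_rectangles\<close>; on \<open>[a, 1]\<close> use \<open>slice_lower\<close>.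
\<close>

lemma integral_slice_lower:
  assumes "0 \<le> a" "a \<le> 1"
  shows "a * slice C 0 + 5/6 - a/4 - a^3/12 \<le> 2 * integral {0..1} (slice C)"
proof -
  have cs: "continuous_on A (slice C)" for A by (rule continuous_slice[OF C])
  have cs': "continuous_on A (\<lambda>h. slice C (a - h))" for A
    by (rule continuous_on_compose2[OF cs[of UNIV]]) (auto intro!: continuous_intros)
  have "integral {0..a} (\<lambda>h. slice C (a - h)) = integral {0..a} (slice C)"
    using integral_shift[of "-a" 0 "\<lambda>h. slice C h" a]
      Henstock_Kurzweil_Integration.integral_reflect_real[of a 0 "\<lambda>h. slice C (a - h)"] 
    by (simp add: add.commute)
  then have "2 * integral {0..a} (slice C) = integral {0..a} (\<lambda>h. slice C h + slice C (a - h))"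
    by (subst Henstock_Kurzweil_Integration.integral_add) (auto intro: integrable_on_Icc cs cs')
  moreover have "integral {0..a} (\<lambda>h. slice C 0 + slice C a) \<le> integral {0..a} (\<lambda>h. slice C h + slice C (a - h))"
    using assms slice_rectangles
    by (intro integral_le integrable_add integrable_on_Icc cs cs') auto
  ultimately have 1: "a * (slice C 0 + slice C a) \<le> 2 * integral {0..a} (slice C)"
    using assms by simp
  define P where "P = (1 - a)/2 - (1 - a)^3/12"
  define Q where "Q = a * (1/2 - (1 - a)\<^sup>2 / 4)"
  have "integral {a..1} (\<lambda>h. 1/2 - (1 - h)\<^sup>2 / 4) \<le> integral {a..1} (slice C)"
    using assms slice_lower by (intro integral_le integrable_on_Icc cs continuous_intros) auto
  moreover have "integral {a..1} (\<lambda>h. 1/2 - (1 - h)\<^sup>2 / 4) = P"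
    unfolding P_def using assms
    by (intro integral_by_antiderivative[of _ _ "\<lambda>h. h/2 + (1 - h)^3/12"])
      (auto intro!: derivative_eq_intros simp: power2_eq_square field_simps)
  ultimately have 2: "P \<le> integral {a..1} (slice C)" by simp
  have 3: "Q \<le> a * slice C a"
    unfolding Q_def using assms slice_lower by (intro mult_left_mono) auto
  have "integral {0..1} (slice C) = integral {0..a} (slice C) + integral {a..1} (slice C)"
    using assms by (intro integral_split cs) auto
  then have "a * slice C 0 + Q + 2 * P \<le> 2 * integral {0..1} (slice C)"
    using 1[unfolded distrib_left] 2 3 by linarith
  moreover have "a * slice C 0 + Q + 2 * P = a * slice C 0 + 5/6 - a/4 - a^3/12"
    unfolding P_def Q_def by (simp add: power2_eq_square power3_eq_cube field_simps)
  ultimately show ?thesis by simp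
qed

end

context
  fixes C assumes C: "copula C"
begin

lemma slice_0_flipped: "slice (flipped C) 0 = slice C 0"
  by (simp add: slice_def plane_ext_flipped[of C])

lemma integral_slices_sum:
  "integral {a..b} (\<lambda>h. slice C h + slice (flipped C) h)
    = integral {a..b} (slice C) + integral {a..b} (slice (flipped C))"
  by (intro Henstock_Kurzweil_Integration.integral_add integrable_on_Icc continuous_slice C copula_flipped)

lemma double_integral_lower:
  assumes "0 \<le> a" "a \<le> 1"
  shows "1/6 + a * (slice C 0 - 1/4) - a^3/12 \<le> integral ({0..1} \<times> {0..1}) (\<lambda>(u, v). C u v)"
  using double_integral_two_slices[OF C] integral_slice_lower[OF C assms]
    integral_slice_lower[OF copula_flipped[OF C] assms]
  by (simp add: integral_slices_sum slice_0_flipped algebra_simps)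

text \<open>
  On \<open>[0, k]\<close> use \<open>slice_squares\<close>, on \<open>[k, 1]\<close> the trivial bound \<open>slice_upper\<close>.
\<close>

lemma double_integral_upper:
  assumes "0 \<le> k" "k \<le> 1"
  shows "integral ({0..1} \<times> {0..1}) (\<lambda>(u, v). C u v) \<le> 1/3 - k + 2 * k * slice C 0 + k\<^sup>2/2"
proof -
  let ?S = "\<lambda>h. slice C h + slice (flipped C) h"
  have c: "continuous_on A ?S" for A
    by (intro continuous_intros continuous_slice C copula_flipped)
  have "integral {0..k} ?S \<le> integral {0..k} (\<lambda>h. 2 * slice C 0 + h)"
    using slice_squares[OF C] assms by (intro integral_le integrable_on_Icc c continuous_intros) auto
  also have "\<dots> = 2 * k * slice C 0 + k\<^sup>2/2"
    using assms by (intro integral_by_antiderivative[of _ _ "\<lambda>h. 2 * h * slice C 0 + h\<^sup>2/2"])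
      (auto intro!: derivative_eq_intros)
  finally have "integral {0..k} ?S \<le> 2 * k * slice C 0 + k\<^sup>2/2" .
  moreover have "integral {k..1} ?S \<le> integral {k..1} (\<lambda>h. 1)"
    using slice_upper[OF C] slice_upper[OF copula_flipped[OF C]] assms
    by (intro integral_le integrable_on_Icc c continuous_intros) (smt (verit) atLeastAtMost_iff field_sum_of_halves)
  moreover have "integral {0..1} ?S = integral {0..k} ?S + integral {k..1} ?S"
    using assms by (intro integral_split c) auto
  ultimately show ?thesis
    using double_integral_two_slices[OF C] assms by simp
qed

section \<open>Bounds for rho in terms of the footrule\<close>

lemma slice_0_bounds: "1/4 \<le> slice C 0" "slice C 0 \<le> 1/2"
  using slice_lower[OF C, of 0] slice_upper[OF C, of 0] by auto

lemma footrule_slice: "spearman_footrule C = 6 * slice C 0 - 2"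
  by (simp add: spearman_footrule_def slice_0)

lemma footrule_range: "spearman_footrule C \<in> {-1/2..1}"
  using slice_0_bounds by (simp add: footrule_slice)

text \<open>
  The choice \<open>k = 1 - 2 * slice C 0\<close> minimises the right-hand side of \<open>double_integral_upper\<close>.
\<close>

lemma rho_upper: "spearman_rho C \<le> 1 - 2/3 * (1 - spearman_footrule C)\<^sup>2"
proof -
  let ?k = "1 - 2 * slice C 0"
  have "integral ({0..1} \<times> {0..1}) (\<lambda>(u, v). C u v) \<le> 1/3 - ?k + 2 * ?k * slice C 0 + ?k\<^sup>2/2"
    using slice_0_bounds by (intro double_integral_upper) auto
  then show ?thesis
    by (simp add: spearman_rho_def footrule_slice power2_eq_square field_simps)
qed

text \<open>
  The parameter \<open>a\<close>, which makes the lower curve a polynomial, is also the side length for which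
  \<open>double_integral_lower\<close> is strongest: there \<open>slice C 0 - 1/4 = a\<^sup>2/4\<close>.
\<close>

lemma rho_lower_param:
  assumes "0 \<le> a" "spearman_footrule C = (3 * a\<^sup>2 - 1) / 2"
  shows "2 * a^3 - 1 \<le> spearman_rho C"
proof -
  have s: "slice C 0 - 1/4 = a\<^sup>2/4"
    using assms(2) by (simp add: footrule_slice)
  then have "a\<^sup>2 \<le> 1" using slice_0_bounds by simp
  then have "a \<le> 1" using assms(1) by (simp add: power2_le_iff_abs_le abs_square_le_1)
  from double_integral_lower[OF assms(1) this] show ?thesis
    unfolding s by (simp add: spearman_rho_def power2_eq_square power3_eq_cube)
qed

end

section \<open>Symmetric copulas\<close>

text \<open>
  By symmetry the lower left corner of a rectangle may be taken above the diagonal.  Such a rectangle splits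
  into pieces above or below the diagonal and one square on the diagonal.
\<close>

lemma copula_symmetricI:
  assumes sym: "\<And>u v. C u v = C v u"
    and zero: "\<And>u. 0 \<le> u \<Longrightarrow> u \<le> 1 \<Longrightarrow> C u 0 = 0"
    and one: "\<And>u. 0 \<le> u \<Longrightarrow> u \<le> 1 \<Longrightarrow> C u 1 = u"
    and above: "\<And>u1 u2 v1 v2. \<lbrakk>0 \<le> u1; u1 \<le> u2; u2 \<le> v1; v1 \<le> v2; v2 \<le> 1\<rbrakk>
      \<Longrightarrow> C u1 v2 + C u2 v1 \<le> C u2 v2 + C u1 v1"
    and diag: "\<And>u v. \<lbrakk>0 \<le> u; u \<le> v; v \<le> 1\<rbrakk> \<Longrightarrow> 2 * C u v \<le> C u u + C v v"
  shows "copula C"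
proof -
  have same_corner: "C w v + C u w \<le> C u v + C w w"
    if "0 \<le> w" "w \<le> u" "u \<le> v" "v \<le> 1" for u v w
    using above[of w u u v] diag[of w u] sym that by fastforce
  have lower_left: "C u1 v2 + C u2 v1 \<le> C u2 v2 + C u1 v1"
    if "0 \<le> u1" "u1 \<le> u2" "u2 \<le> 1" "u1 \<le> v1" "v1 \<le> v2" "v2 \<le> 1" for u1 u2 v1 v2
  proof (cases "u2 \<le> v1")
    case True
    then show ?thesis using above that by simp
  next
    case False
    have "C u1 v2 + C v1 v1 \<le> C v1 v2 + C u1 v1"
      using above[of u1 v1 v1 v2] that by simp
    moreover have "C v1 v2 + C u2 v1 \<le> C u2 v2 + C v1 v1"
      using same_corner[of v1 u2 v2] same_corner[of v1 v2 u2] that False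
      by (cases "u2 \<le> v2") (simp_all add: sym)
    ultimately show ?thesis by simp
  qed
  have rect: "C u1 v2 + C u2 v1 \<le> C u2 v2 + C u1 v1"
    if "0 \<le> u1" "u1 \<le> u2" "u2 \<le> 1" "0 \<le> v1" "v1 \<le> v2" "v2 \<le> 1" for u1 u2 v1 v2
    using lower_left[of u1 u2 v1 v2] lower_left[of v1 v2 u1 u2] that
    by (cases "u1 \<le> v1") (simp_all add: sym add.commute)
  have zero': "C 0 u = 0" and one': "C 1 u = u" if "0 \<le> u" "u \<le> 1" for u
    using zero[OF that] one[OF that] sym by simp_all
  have "C u v \<in> {0..1}" if "u \<in> {0..1}" "v \<in> {0..1}" for u v
    using rect[of 0 u 0 v] rect[of u 1 0 v] that zero zero' one one' by simp
  then show ?thesis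
    unfolding copula_def using zero one zero' one' rect by (auto simp: algebra_simps)
qed

lemma min_supermodular:
  fixes p1 p2 q1 q2 :: real
  assumes "p1 \<le> p2" "q1 \<le> q2"
  shows "min p1 q2 + min p2 q1 \<le> min p2 q2 + min p1 q1"
  using assms by (auto simp: min_def)

lemma double_integral_symmetric:
  assumes "copula C" "\<And>u v. C u v = C v u"
  shows "integral ({0..1} \<times> {0..1}) (\<lambda>(u, v). C u v) = 2 * integral {0..1} (slice C) - 2/3"
proof -
  have "flipped C = C" using assms(2) by auto
  then show ?thesis
    using double_integral_two_slices[OF assms(1)] integral_slices_sum[OF assms(1)] by simp
qed

section \<open>Copulas on the lower curve\<close>

text \<open>
  All mass lies on the antidiagonal, except in the square \<open>[c, 1 - c]\<^sup>2\<close>, where it lies on the diagonal.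
\<close>

definition central_copula :: "real \<Rightarrow> real \<Rightarrow> real \<Rightarrow> real" where
  "central_copula c u v = max 0 (max (u + v - 1) (min u v - c))"

lemma copula_central:
  assumes c: "0 \<le> c" "c \<le> 1/2"
  shows "copula (central_copula c)"
proof (rule copula_symmetricI)
  fix u1 u2 v1 v2 :: real
  assume le: "0 \<le> u1" "u1 \<le> u2" "u2 \<le> v1" "v1 \<le> v2" "v2 \<le> 1"
  \<comment> \<open>above the diagonal the function is \<open>u\<close> minus the minimum of an increasing function of \<open>u\<close> and a decreasing one of \<open>v\<close>\<close>
  have *: "central_copula c u v = u - min (min u c) (1 - v)" if "u \<le> v" "v \<le> 1" for u v
    using that unfolding central_copula_def by (auto simp: min_def max_def)
  have "min (min u1 c) (1 - v1) + min (min u2 c) (1 - v2) \<le> min (min u2 c) (1 - v1) + min (min u1 c) (1 - v2)"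
    using le by (intro min_supermodular) auto
  with le show "central_copula c u1 v2 + central_copula c u2 v1 \<le> central_copula c u2 v2 + central_copula c u1 v1"
    by (simp add: * min.commute)
next
  fix u v :: real assume "0 \<le> u" "u \<le> v" "v \<le> 1"
  then show "2 * central_copula c u v \<le> central_copula c u u + central_copula c v v"
    using c unfolding central_copula_def by (auto simp: min_def max_def)
qed (use c in \<open>auto simp: central_copula_def min_def max_def\<close>)

lemma integral_two_ramps:
  fixes p q L :: real
  assumes "0 \<le> p" "p \<le> L" "0 \<le> q" "q \<le> L"
  shows "integral {0..L} (\<lambda>t. max 0 (t - p) + max 0 (t - q)) = ((L - p)\<^sup>2 + (L - q)\<^sup>2) / 2"
  using assms
  by (subst Henstock_Kurzweil_Integration.integral_add)
    (auto intro!: integrable_on_Icc continuous_intros simp: integral_ramp field_simps)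

text \<open>
  The line \<open>v = u + h\<close> meets the central square iff \<open>h \<le> 1 - 2 * c\<close>; otherwise the slice is that of the
  smallest copula.
\<close>

lemma slice_central:
  assumes c: "0 \<le> c" "c \<le> 1/2" and h: "0 \<le> h" "h \<le> 1"
  shows "h \<le> 1 - 2*c \<Longrightarrow> slice (central_copula c) h = ((1 - h - c)\<^sup>2 + c\<^sup>2) / 2 + (h - h\<^sup>2/2)"
    and "1 - 2*c \<le> h \<Longrightarrow> slice (central_copula c) h = (1 - h)\<^sup>2 / 4 + (h - h\<^sup>2/2)"
proof -
  let ?C = "central_copula c"
  have s: "slice ?C h = integral {0..1-h} (\<lambda>t. ?C t (t + h)) + (h - h\<^sup>2 / 2)"
    by (rule slice_tail[OF copula_central[OF c] h])
  show "slice ?C h = ((1 - h - c)\<^sup>2 + c\<^sup>2) / 2 + (h - h\<^sup>2/2)" if "h \<le> 1 - 2*c"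
  proof -
    have "integral {0..1-h} (\<lambda>t. ?C t (t + h)) = integral {0..1-h} (\<lambda>t. max 0 (t - c) + max 0 (t - (1 - c - h)))"
      using that c h by (intro integral_cong) (auto simp: central_copula_def min_def max_def)
    also have "\<dots> = ((1 - h - c)\<^sup>2 + c\<^sup>2) / 2"
      using that c h by (subst integral_two_ramps) auto
    finally show ?thesis using s by simp
  qed
  show "slice ?C h = (1 - h)\<^sup>2 / 4 + (h - h\<^sup>2/2)" if "1 - 2*c \<le> h"
  proof -
    have "integral {0..1-h} (\<lambda>t. ?C t (t + h)) = integral {0..1-h} (\<lambda>t. max 0 (t - (1 - h)/2) + max 0 (t - (1 - h)/2))"
      using that c h by (intro integral_cong) (auto simp: central_copula_def min_def max_def field_simps)
    also have "\<dots> = (1 - h)\<^sup>2 / 4"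
      using that c h by (subst integral_two_ramps) (auto simp: power2_eq_square field_simps)
    finally show ?thesis using s by simp
  qed
qed

lemma lower_boundary_attained:
  assumes a: "0 \<le> a" "a \<le> 1"
  obtains C where "copula C" "spearman_footrule C = (3 * a\<^sup>2 - 1) / 2" "spearman_rho C = 2 * a^3 - 1"
proof
  define c where "c = (1 - a) / 2"
  have c: "0 \<le> c" "c \<le> 1/2" "1 - 2 * c = a" using a by (auto simp: c_def field_simps)
  let ?C = "central_copula c"
  show C: "copula ?C" by (rule copula_central[OF c(1,2)])
  show "spearman_footrule ?C = (3 * a\<^sup>2 - 1) / 2"
    using slice_central(1)[OF c(1,2), of 0] c a
    unfolding footrule_slice[OF C] by (simp add: c_def power2_eq_square field_simps)
  have "integral {0..1} (slice ?C) = integral {0..a} (slice ?C) + integral {a..1} (slice ?C)"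
    using a by (intro integral_split continuous_slice C) auto
  also have "integral {0..a} (slice ?C) = integral {0..a} (\<lambda>h. ((1 - h - c)\<^sup>2 + c\<^sup>2) / 2 + (h - h\<^sup>2/2))"
    using a c slice_central(1)[OF c(1,2)] by (intro integral_cong) auto
  also have "\<dots> = ((1 - c)^3 - (1 - a - c)^3)/6 + a * c\<^sup>2 / 2 + a\<^sup>2/2 - a^3/6"
    by (rule integral_by_antiderivative[OF a(1), of "\<lambda>h. h * c\<^sup>2 / 2 + h\<^sup>2/2 - h^3/6 - (1 - h - c)^3/6"])
      (auto intro!: derivative_eq_intros simp: field_simps)
  also have "integral {a..1} (slice ?C) = integral {a..1} (\<lambda>h. (1 - h)\<^sup>2 / 4 + (h - h\<^sup>2/2))"
    using a c slice_central(2)[OF c(1,2)] by (intro integral_cong) auto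
  also have "\<dots> = (1 - a)^3/12 + 1/2 - 1/6 - a\<^sup>2/2 + a^3/6"
    by (rule integral_by_antiderivative[OF a(2), of "\<lambda>h. h\<^sup>2/2 - h^3/6 - (1 - h)^3/12"])
      (auto intro!: derivative_eq_intros simp: field_simps)
  finally have "integral {0..1} (slice ?C) = 5/12 + a^3/12"
    by (simp add: c_def power2_eq_square power3_eq_cube field_simps)
  moreover have "central_copula c u v = central_copula c v u" for u v
    by (simp add: central_copula_def min.commute add.commute)
  ultimately show "spearman_rho ?C = 2 * a^3 - 1"
    using double_integral_symmetric[OF C] by (simp add: spearman_rho_def)
qed

section \<open>The largest symmetric copula with a given diagonal section\<close>

text \<open>
  The copula of Fredricks and Nelsen with diagonal section \<open>\<delta> t = t - T t\<close>, that is,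
  \<open>min (min u v) ((\<delta> u + \<delta> v) / 2)\<close>.  In terms of the gap \<open>T\<close> the conditions on \<open>\<delta>\<close> become a single
  Lipschitz condition.
\<close>

definition diagonal_copula :: "(real \<Rightarrow> real) \<Rightarrow> real \<Rightarrow> real \<Rightarrow> real" where
  "diagonal_copula T u v = min (min u v) ((u + v - T u - T v) / 2)"

locale diagonal_gap =
  fixes T :: "real \<Rightarrow> real"
  assumes lip: "\<And>x y. x \<le> y \<Longrightarrow> \<bar>T x - T y\<bar> \<le> y - x"
    and nonneg: "\<And>x. 0 \<le> x \<Longrightarrow> x \<le> 1 \<Longrightarrow> 0 \<le> T x"
    and ends: "T 0 = 0" "T 1 = 0"
begin

abbreviation "K \<equiv> diagonal_copula T"

lemma symmetric: "K u v = K v u"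
  by (simp add: diagonal_copula_def min.commute algebra_simps)

lemma copula: "copula K"
proof (rule copula_symmetricI)
  fix u :: real assume u: "0 \<le> u" "u \<le> 1"
  show "K u 0 = 0" "K u 1 = u"
    using lip[of 0 u] lip[of u 1] u ends by (auto simp: diagonal_copula_def min_def)
next
  fix u1 u2 v1 v2 :: real
  assume le: "0 \<le> u1" "u1 \<le> u2" "u2 \<le> v1" "v1 \<le> v2" "v2 \<le> 1"
  \<comment> \<open>a function of \<open>u\<close> plus the minimum of increasing functions of \<open>u\<close> and of \<open>v\<close>\<close>
  have *: "K u v = (u - T u)/2 + min ((u + T u)/2) ((v - T v)/2)" if "u \<le> v" for u v
    using that by (simp add: diagonal_copula_def min_def field_simps)
  have "min ((u1 + T u1)/2) ((v2 - T v2)/2) + min ((u2 + T u2)/2) ((v1 - T v1)/2)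
    \<le> min ((u2 + T u2)/2) ((v2 - T v2)/2) + min ((u1 + T u1)/2) ((v1 - T v1)/2)"
    using le lip[of u1 u2] lip[of v1 v2] by (intro min_supermodular) auto
  with le show "K u1 v2 + K u2 v1 \<le> K u2 v2 + K u1 v1"
    by (simp add: *)
next
  fix u v :: real assume "0 \<le> u" "u \<le> v" "v \<le> 1"
  then show "2 * K u v \<le> K u u + K v v"
    using nonneg[of u] nonneg[of v] by (auto simp: diagonal_copula_def min_def field_simps)
qed (rule symmetric)

lemma continuous_gap: "continuous_on A T"
proof (rule continuous_onI)
  fix x e :: real assume "e > 0"
  have "\<bar>T y - T x\<bar> \<le> \<bar>y - x\<bar>" for y
    using lip[of x y] lip[of y x] by (cases "x \<le> y") (auto simp: abs_minus_commute)
  then show "\<exists>d>0. \<forall>x'\<in>A. dist x' x < d \<longrightarrow> dist (T x') (T x) \<le> e"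
    using \<open>e > 0\<close> by (intro exI[of _ e]) (auto simp: dist_real_def intro: order_trans less_imp_le)
qed

lemma continuous_gap_compose [continuous_intros]: "continuous_on A f \<Longrightarrow> continuous_on A (\<lambda>x. T (f x))"
  using continuous_on_compose2[OF continuous_gap[of UNIV]] by auto

lemma slice_diagonal_copula:
  assumes "0 \<le> h" "h \<le> 1"
  shows "slice K h = 1/2 - integral {0..1-h} (\<lambda>t. max 0 (T t + T (t + h) - h)) / 2"
proof -
  have "integral {0..1-h} (\<lambda>t. K t (t + h)) = integral {0..1-h} (\<lambda>t. t - max 0 (T t + T (t + h) - h) / 2)"
    using assms by (intro integral_cong) (auto simp: diagonal_copula_def min_def max_def field_simps)
  also have "\<dots> = (1 - h)\<^sup>2/2 - integral {0..1-h} (\<lambda>t. max 0 (T t + T (t + h) - h)) / 2"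
    using assms
    by (subst Henstock_Kurzweil_Integration.integral_diff)
      (auto intro!: integrable_on_Icc continuous_intros simp: integral_id)
  finally show ?thesis
    unfolding slice_tail[OF copula assms] by (simp add: power2_eq_square field_simps)
qed

lemma slice_diagonal_0: "slice K 0 = 1/2 - integral {0..1} T"
proof -
  have "integral {0..1} (\<lambda>t. max 0 (T t + T t)) = integral {0..1} (\<lambda>t. 2 * T t)"
    using nonneg by (intro integral_cong) auto
  then show ?thesis using slice_diagonal_copula[of 0] by simp
qed

text \<open>
  The condition says that \<open>K t (t + h) = t\<close>, the value for the largest copula.
\<close>

lemma slice_small_gap:
  assumes "0 \<le> h" "h \<le> 1" and "\<And>t. 0 \<le> t \<Longrightarrow> t + h \<le> 1 \<Longrightarrow> T t + T (t + h) \<le> h"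
  shows "slice K h = 1/2"
proof -
  have "integral {0..1-h} (\<lambda>t. max 0 (T t + T (t + h) - h)) = integral {0..1-h} (\<lambda>t. 0)"
    using assms by (intro integral_cong) auto
  then show ?thesis using slice_diagonal_copula[OF assms(1,2)] by simp
qed

text \<open>
  The condition says that \<open>K t (t + h)\<close> is the average of the diagonal values at \<open>t\<close> and \<open>t + h\<close>.  Near the
  ends of the unit interval it forces \<open>T\<close> to be at least the distance to the end, which controls the parts of
  the integral of \<open>T\<close> that the shifted copy omits.
\<close>

lemma slice_large_gap:
  assumes h: "0 \<le> h" "h \<le> 1" and le: "\<And>t. 0 \<le> t \<Longrightarrow> t + h \<le> 1 \<Longrightarrow> h \<le> T t + T (t + h)"
  shows "slice K 0 + h/2 \<le> slice K h"
proof -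
  have i: "T integrable_on {a..b}" "(\<lambda>t. T (t + h)) integrable_on {a..b}" for a b
    by (intro integrable_on_Icc continuous_intros)+
  have "integral {0..1-h} (\<lambda>t. max 0 (T t + T (t + h) - h)) = integral {0..1-h} (\<lambda>t. T t + T (t + h) - h)"
    using le by (intro integral_cong) auto
  also have "\<dots> = integral {0..1-h} T + integral {0..1-h} (\<lambda>t. T (t + h)) - h * (1 - h)"
    using h i by (subst Henstock_Kurzweil_Integration.integral_diff)
      (auto simp: Henstock_Kurzweil_Integration.integral_add integrable_add)
  also have "\<dots> = 2 * integral {0..1} T - integral {0..h} T - integral {1-h..1} T - h * (1 - h)"
    using integral_split[OF continuous_gap, of 0 h 1] integral_split[OF continuous_gap, of 0 "1-h" 1] h
      integral_shift[of 0 "1-h" T h]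
    by simp
  finally have deficit: "integral {0..1-h} (\<lambda>t. max 0 (T t + T (t + h) - h)) =
    2 * integral {0..1} T - integral {0..h} T - integral {1-h..1} T - h * (1 - h)" .
  have "integral {0..h} (\<lambda>t. t) \<le> integral {0..h} T"
  proof (intro integral_le i integrable_on_Icc continuous_intros)
    fix t assume "t \<in> {0..h}"
    then show "t \<le> T t" using lip[of t h] le[of 0] ends h by auto
  qed
  then have left: "h\<^sup>2/2 \<le> integral {0..h} T"
    using h by (simp add: integral_id)
  have "integral {1-h..1} (\<lambda>t. 1 - t) \<le> integral {1-h..1} T"
  proof (intro integral_le i integrable_on_Icc continuous_intros)
    fix t assume "t \<in> {1-h..1}"
    then show "1 - t \<le> T t" using lip[of "1-h" t] le[of "1-h"] ends h by auto
  qed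
  moreover have "integral {1-h..1} (\<lambda>t. 1 - t) = h\<^sup>2 / 2"
    using h by (intro integral_by_antiderivative[of _ _ "\<lambda>t. - (1 - t)\<^sup>2 / 2"])
      (auto intro!: derivative_eq_intros simp: field_simps)
  ultimately show ?thesis
    unfolding slice_diagonal_copula[OF h] slice_diagonal_0 deficit
    using left by (simp add: power2_eq_square field_simps)
qed

end

section \<open>Copulas on the curved part of the lower estimate\<close>

text \<open>
  The gap of \<open>central_copula c\<close>: the copulas on the curved part of \<open>r_lower\<close> have the same diagonal
  sections, hence the same footrule, as those on the lower curve.
\<close>

definition trapezoid_gap :: "real \<Rightarrow> real \<Rightarrow> real" where
  "trapezoid_gap c t = min t (min c (1 - t))"

lemma diagonal_gap_trapezoid: "0 \<le> c \<Longrightarrow> diagonal_gap (trapezoid_gap c)"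
  by unfold_locales (auto simp: trapezoid_gap_def min_def abs_if)

lemma integral_trapezoid_gap:
  assumes "0 \<le> c" "c \<le> 1/2"
  shows "integral {0..1} (trapezoid_gap c) = c - c\<^sup>2"
proof -
  have "integral {0..1} (trapezoid_gap c) = integral {0..1} (\<lambda>t. t - (max 0 (t - c) + max 0 (t - (1 - c))))"
    using assms by (intro integral_cong) (auto simp: trapezoid_gap_def min_def max_def)
  also have "\<dots> = integral {0..1} (\<lambda>t. t) - integral {0..1} (\<lambda>t. max 0 (t - c) + max 0 (t - (1 - c)))"
    by (intro Henstock_Kurzweil_Integration.integral_diff integrable_on_Icc continuous_intros)
  also have "\<dots> = c - c\<^sup>2"
    using assms by (subst integral_two_ramps) (auto simp: integral_id power2_eq_square field_simps)
  finally show ?thesis .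
qed

text \<open>
  For these \<open>h\<close> the integrand in \<open>slice_diagonal_copula\<close> is a trapezoid with slopes \<open>1\<close> and \<open>-1\<close>.  It is
  bounded by a sum of four ramps that start at its corners; the formula is the same whichever of the corners
  \<open>c\<close> and \<open>1 - c - h\<close> comes first.
\<close>

lemma slice_trapezoid_middle:
  assumes c: "1/4 \<le> c" "c \<le> 1/2" and h: "c \<le> h" "h \<le> 1/2"
  shows "1/2 - (1 - 2*h) * (2*c - h) / 2 \<le> slice (diagonal_copula (trapezoid_gap c)) h"
proof -
  let ?T = "trapezoid_gap c"
  interpret diagonal_gap ?T using c by (intro diagonal_gap_trapezoid) auto
  have "integral {0..1-h} (\<lambda>t. max 0 (?T t + ?T (t + h) - h)) \<le>
    integral {0..1-h} (\<lambda>t. (max 0 (t - (h - c)) + max 0 (t - (1 + c - 2*h)))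
       - (max 0 (t - (1 - c - h)) + max 0 (t - c)))"
  proof (intro integral_le integrable_on_Icc continuous_intros)
    fix t assume "t \<in> {0..1-h}"
    then have "?T t = min t c" "?T (t + h) = min c (1 - t - h)"
      using c h by (auto simp: trapezoid_gap_def)
    then show "max 0 (?T t + ?T (t + h) - h) \<le>
      (max 0 (t - (h - c)) + max 0 (t - (1 + c - 2*h))) - (max 0 (t - (1 - c - h)) + max 0 (t - c))"
      using c h by (auto simp: min_def max_def)
  qed
  also have "\<dots> = integral {0..1-h} (\<lambda>t. max 0 (t - (h - c)) + max 0 (t - (1 + c - 2*h)))
     - integral {0..1-h} (\<lambda>t. max 0 (t - (1 - c - h)) + max 0 (t - c))"
    by (intro Henstock_Kurzweil_Integration.integral_diff integrable_on_Icc continuous_intros)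
  also have "\<dots> = ((1 - 2*h + c)\<^sup>2 + (h - c)\<^sup>2) / 2 - (c\<^sup>2 + (1 - h - c)\<^sup>2) / 2"
    using c h by (subst (1 2) integral_two_ramps) (auto simp: algebra_simps)
  also have "\<dots> = (1 - 2*h) * (2*c - h)"
    by (simp add: power2_eq_square field_simps)
  finally show ?thesis
    using c h by (subst slice_diagonal_copula) auto
qed

text \<open>
  The offsets \<open>h\<close> split into \<open>[0, c]\<close>, where the average in the definition of the copula is the smaller
  term, \<open>[c, 1/2]\<close>, where both terms occur, and \<open>[1/2, 1]\<close>, where the copula has the values of the largest one.
  The condition \<open>a \<le> 1/2\<close>, that is \<open>c \<ge> 1/4\<close>, keeps the height of the trapezoid in the middle
  range nonnegative.
\<close>

lemma left_curve_attained:
  assumes a: "0 \<le> a" "a \<le> 1/2"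
  obtains C where "copula C" "spearman_footrule C = (3 * a\<^sup>2 - 1) / 2"
    "3 * a\<^sup>2 - 1/2 - a^3 \<le> spearman_rho C"
proof
  define c where "c = (1 - a) / 2"
  have c: "1/4 \<le> c" "c \<le> 1/2" using a by (auto simp: c_def field_simps)
  let ?T = "trapezoid_gap c"
  interpret diagonal_gap ?T using c by (intro diagonal_gap_trapezoid) auto
  show "copula K" by (rule copula)
  have s0: "slice K 0 = 1/2 - c + c\<^sup>2"
    using c by (simp add: slice_diagonal_0 integral_trapezoid_gap)
  show "spearman_footrule K = (3 * a\<^sup>2 - 1) / 2"
    unfolding footrule_slice[OF copula] s0 by (simp add: c_def power2_eq_square field_simps)
  have ci: "continuous_on A (slice K)" for A by (rule continuous_slice[OF copula])
  have i1: "integral {0..c} (\<lambda>h. 1/2 - c + c\<^sup>2 + h/2) = c/2 - 3/4 * c\<^sup>2 + c^3" (is "_ = ?I1")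
    using c by (intro integral_by_antiderivative[of _ _ "\<lambda>h. (1/2 - c + c\<^sup>2) * h + h\<^sup>2/4"])
      (auto intro!: derivative_eq_intros simp: power2_eq_square power3_eq_cube field_simps)
  have "integral {0..c} (\<lambda>h. 1/2 - c + c\<^sup>2 + h/2) \<le> integral {0..c} (slice K)"
  proof (intro integral_le integrable_on_Icc ci continuous_intros)
    fix h assume "h \<in> {0..c}"
    then have "slice K 0 + h/2 \<le> slice K h"
      using c by (intro slice_large_gap) (auto simp: trapezoid_gap_def min_def)
    then show "1/2 - c + c\<^sup>2 + h/2 \<le> slice K h" by (simp add: s0)
  qed auto
  note b1 = this[unfolded i1]
  have i2: "integral {c..1/2} (\<lambda>h. 1/2 - (1 - 2*h) * (2*c - h) / 2)
    = (1/2 - c) * (1/2 - c) + (1/2 + 2*c) * (1/4 - c\<^sup>2) / 2 - (1/8 - c^3) / 3" (is "_ = ?I2")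
    using c by (intro integral_by_antiderivative[of _ _ "\<lambda>h. h/2 - c * h + (1/2 + 2*c) * h\<^sup>2 / 2 - h^3/3"])
      (auto intro!: derivative_eq_intros simp: power2_eq_square power3_eq_cube field_simps)
  have "integral {c..1/2} (\<lambda>h. 1/2 - (1 - 2*h) * (2*c - h) / 2) \<le> integral {c..1/2} (slice K)"
    using slice_trapezoid_middle c by (intro integral_le integrable_on_Icc ci continuous_intros) auto
  note b2 = this[unfolded i2]
  have "integral {1/2..1} (\<lambda>h::real. 1/2) \<le> integral {1/2..1} (slice K)"
  proof (intro integral_le integrable_on_Icc ci continuous_intros)
    fix h :: real assume "h \<in> {1/2..1}"
    then have "slice K h = 1/2"
      by (intro slice_small_gap) (auto simp: trapezoid_gap_def min_def)
    then show "1/2 \<le> slice K h" by simp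
  qed
  then have b3: "1/4 \<le> integral {1/2..1} (slice K)" by simp
  have "integral {0..1} (slice K) = integral {0..c} (slice K) + (integral {c..1/2} (slice K) + integral {1/2..1} (slice K))"
    using c integral_split[OF ci, of 0 c 1] integral_split[OF ci, of c "1/2" 1] by simp
  then have "?I1 + (?I2 + 1/4) \<le> integral {0..1} (slice K)"
    by (simp only:) (intro add_mono b1 b2 b3)
  then show "3 * a\<^sup>2 - 1/2 - a^3 \<le> spearman_rho K"
    using double_integral_symmetric[OF copula symmetric]
    by (simp add: spearman_rho_def c_def power2_eq_square power3_eq_cube field_simps)
qed

section \<open>Copulas on the upper bound\<close>

text \<open>
  The distance from \<open>t\<close> to the multiples of \<open>1/n\<close>.
\<close>

definition grid_gap :: "nat \<Rightarrow> real \<Rightarrow> real" where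
  "grid_gap n t = \<bar>real n * t - of_int (round (real n * t))\<bar> / real n"

lemma dist_round_half: "\<bar>z - of_int (round z)\<bar> + \<bar>(z + 1/2) - of_int (round (z + 1/2))\<bar> = (1/2::real)"
proof -
  define m where "m = \<lfloor>z\<rfloor>"
  have m: "of_int m \<le> z" "z < of_int m + 1" by (simp_all add: m_def)
  show ?thesis
  proof (cases "z < of_int m + 1/2")
    case True
    have "round z = m" "round (z + 1/2) = m + 1"
      using m True by (auto simp: round_def intro!: floor_unique)
    then show ?thesis using m True by simp
  next
    case False
    have "round z = m + 1" "round (z + 1/2) = m + 1"
      using m False by (auto simp: round_def intro!: floor_unique)
    then show ?thesis using m False by simp
  qed
qed

context
  fixes n :: nat assumes n: "n \<ge> 1"
begin

text \<open>
  This identity and the Lipschitz property yield the hypotheses of both \<open>slice_large_gap\<close>, for \<open>h\<close> up to the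
  half step \<open>1/(2n)\<close>, and \<open>slice_small_gap\<close>, for larger \<open>h\<close>; at the half step itself both hold.
\<close>

lemma grid_gap_half_step: "grid_gap n t + grid_gap n (t + 1 / (2 * real n)) = 1 / (2 * real n)"
proof -
  have "real n * (t + 1 / (2 * real n)) = real n * t + 1/2" using n by (simp add: field_simps)
  then have "grid_gap n t + grid_gap n (t + 1 / (2 * real n)) =
    (\<bar>real n * t - of_int (round (real n * t))\<bar> + \<bar>(real n * t + 1/2) - of_int (round (real n * t + 1/2))\<bar>) / real n"
    unfolding grid_gap_def by (simp add: add_divide_distrib)
  then show ?thesis
    unfolding dist_round_half by simp
qed

lemma grid_gap_lipschitz: "\<bar>grid_gap n x - grid_gap n y\<bar> \<le> \<bar>x - y\<bar>"
proof -
  have *: "grid_gap n x \<le> grid_gap n y + \<bar>x - y\<bar>" for x y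
  proof -
    have "\<bar>real n * x - of_int (round (real n * x))\<bar> \<le> \<bar>real n * x - of_int (round (real n * y))\<bar>"
      using round_diff_minimal[of "real n * x" "round (real n * y)"] by simp
    also have "\<dots> \<le> \<bar>real n * y - of_int (round (real n * y))\<bar> + \<bar>real n * x - real n * y\<bar>" by simp
    also have "\<bar>real n * x - real n * y\<bar> = real n * \<bar>x - y\<bar>"
      by (simp add: abs_mult flip: right_diff_distrib)
    finally show ?thesis using n by (simp add: grid_gap_def field_simps)
  qed
  show ?thesis using *[of x y] *[of y x] by (simp add: abs_minus_commute abs_le_iff)
qed

lemma grid_gap_periodic: "grid_gap n (t + 1) = grid_gap n t"
proof -
  have "round (real n * (t + 1)) = round (real n * t) + int n"
    by (simp add: round_def distrib_left) linarith
  then show ?thesis by (simp add: grid_gap_def distrib_left)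
qed

lemma diagonal_gap_grid: "diagonal_gap (grid_gap n)"
proof
  show "\<bar>grid_gap n x - grid_gap n y\<bar> \<le> y - x" if "x \<le> y" for x y
    using grid_gap_lipschitz[of x y] that by simp
qed (auto simp: grid_gap_def)

text \<open>
  In terms of random variables, \<open>\<bar>U - V\<bar>\<close> is constantly \<open>1/(2n)\<close>, which is the case of equality in the upper
  bound.
\<close>

lemma touching_point_attained:
  obtains C where "copula C" "spearman_footrule C = 1 - 3 / (2 * real n)"
    "1 - 3 / (2 * (real n)\<^sup>2) \<le> spearman_rho C"
proof
  define k where "k = 1 / (2 * real n)"
  have k: "0 < k" "k \<le> 1/2" using n by (auto simp: k_def field_simps)
  let ?T = "grid_gap n"
  interpret diagonal_gap ?T by (rule diagonal_gap_grid)
  show "copula K" by (rule copula)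
  have step: "?T t + ?T (t + k) = k" for t
    using grid_gap_half_step by (simp add: k_def)
  \<comment> \<open>by periodicity the gap and its shift by \<open>k\<close> have the same integral\<close>
  have "integral {0..1} (\<lambda>t. ?T t + ?T (t + k)) = k" by (simp add: step)
  moreover have "integral {0..1} (\<lambda>t. ?T t + ?T (t + k)) = integral {0..1} ?T + integral {k..1+k} ?T"
    using integral_shift[of 0 1 ?T k]
    by (subst Henstock_Kurzweil_Integration.integral_add) (auto intro!: integrable_on_Icc continuous_intros)
  moreover have "integral {k..1+k} ?T = integral {k..1} ?T + integral {1..1+k} ?T"
    using k by (intro integral_split continuous_gap) auto
  moreover have "integral {1..1+k} ?T = integral {0..k} ?T"
    using integral_shift[of 0 k ?T 1] by (simp add: grid_gap_periodic add.commute)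
  moreover have "integral {0..1} ?T = integral {0..k} ?T + integral {k..1} ?T"
    using k by (intro integral_split continuous_gap) auto
  ultimately have s0: "slice K 0 = 1/2 - k/2" by (simp add: slice_diagonal_0)
  show "spearman_footrule K = 1 - 3 / (2 * real n)"
    unfolding footrule_slice[OF copula] s0 by (simp add: k_def)
  have ci: "continuous_on A (slice K)" for A by (rule continuous_slice[OF copula])
  have "integral {0..k} (\<lambda>h. 1/2 - k/2 + h/2) \<le> integral {0..k} (slice K)"
  proof (intro integral_le integrable_on_Icc ci continuous_intros)
    fix h assume h: "h \<in> {0..k}"
    have "h \<le> ?T t + ?T (t + h)" for t
      using step[of t] grid_gap_lipschitz[of "t + k" "t + h"] h by auto
    then have "slice K 0 + h/2 \<le> slice K h"
      using h k by (intro slice_large_gap) auto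
    then show "1/2 - k/2 + h/2 \<le> slice K h" by (simp add: s0)
  qed auto
  moreover have "integral {0..k} (\<lambda>h. 1/2 - k/2 + h/2) = k/2 - k\<^sup>2/4"
    using k by (intro integral_by_antiderivative[of _ _ "\<lambda>h. (1/2 - k/2) * h + h\<^sup>2/4"])
      (auto intro!: derivative_eq_intros simp: power2_eq_square field_simps)
  moreover have "integral {k..1} (\<lambda>h. 1/2) \<le> integral {k..1} (slice K)"
  proof (intro integral_le integrable_on_Icc ci continuous_intros)
    fix h assume h: "h \<in> {k..1}"
    have "?T t + ?T (t + h) \<le> h" for t
      using step[of t] grid_gap_lipschitz[of "t + k" "t + h"] h by auto
    then have "slice K h = 1/2"
      using h k by (intro slice_small_gap) auto
    then show "1/2 \<le> slice K h" by simp
  qed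
  moreover have "integral {0..1} (slice K) = integral {0..k} (slice K) + integral {k..1} (slice K)"
    using k by (intro integral_split ci) auto
  moreover have "integral {k..1} (\<lambda>h. 1/2 :: real) = 1/2 - k/2" using k by simp
  ultimately have "1/2 - k\<^sup>2/4 \<le> integral {0..1} (slice K)" by linarith
  then have "1 - 6 * k\<^sup>2 \<le> spearman_rho K"
    using double_integral_symmetric[OF copula symmetric] by (simp add: spearman_rho_def)
  then show "1 - 3 / (2 * (real n)\<^sup>2) \<le> spearman_rho K"
    by (simp add: k_def power_divide power_mult_distrib)
qed

end

section \<open>Mixtures and limits of copulas\<close>

lemma rho_slice:
  assumes "copula C"
  shows "spearman_rho C = 12 * integral {-1..1} (slice C) - 7"
  using double_integral_slices[OF assms] by (simp add: spearman_rho_def)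

lemma copula_mix:
  assumes "copula C" "copula D" "0 \<le> p" "0 \<le> q" "p + q = 1"
  shows "copula (\<lambda>u v. p * C u v + q * D u v)"
    and "spearman_footrule (\<lambda>u v. p * C u v + q * D u v) = p * spearman_footrule C + q * spearman_footrule D"
    and "spearman_rho (\<lambda>u v. p * C u v + q * D u v) = p * spearman_rho C + q * spearman_rho D"
proof -
  let ?M = "\<lambda>u v. p * C u v + q * D u v"
  have one: "p * x + q * x = x" for x
    using assms(5) by (metis distrib_right mult_1)
  show M: "copula ?M"
    unfolding copula_def
  proof (intro conjI ballI allI impI)
    fix u v :: real assume uv: "u \<in> {0..1}" "v \<in> {0..1}"
    have "0 \<le> C u v" "C u v \<le> 1" "0 \<le> D u v" "D u v \<le> 1"
      using assms(1,2) uv unfolding copula_def by auto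
    then have "0 \<le> ?M u v" "?M u v \<le> p * 1 + q * 1"
      using assms(3,4) by (simp, intro add_mono mult_left_mono)
    then show "?M u v \<in> {0..1}" using one[of 1] by simp
  next
    fix u1 u2 v1 v2 :: real
    assume "0 \<le> u1 \<and> u1 \<le> u2 \<and> u2 \<le> 1 \<and> 0 \<le> v1 \<and> v1 \<le> v2 \<and> v2 \<le> 1"
    then have "0 \<le> C u2 v2 - C u2 v1 - C u1 v2 + C u1 v1" "0 \<le> D u2 v2 - D u2 v1 - D u1 v2 + D u1 v1"
      using assms(1,2) unfolding copula_def by blast+
    then have "0 \<le> p * (C u2 v2 - C u2 v1 - C u1 v2 + C u1 v1) + q * (D u2 v2 - D u2 v1 - D u1 v2 + D u1 v1)"
      using assms(3,4) by simp
    then show "?M u2 v2 - ?M u2 v1 - ?M u1 v2 + ?M u1 v1 \<ge> 0"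
      by (simp add: algebra_simps)
  qed (use assms(1,2) one in \<open>auto simp: copula_def\<close>)
  have slice: "slice ?M h = p * slice C h + q * slice D h" for h
  proof -
    have "slice ?M h = integral {0..1} (\<lambda>t. p * plane_ext C t (t + h) + q * plane_ext D t (t + h))"
      by (simp add: slice_def plane_ext_def)
    also have "\<dots> = p * slice C h + q * slice D h"
      unfolding slice_def using assms(1,2)
      by (subst Henstock_Kurzweil_Integration.integral_add) (auto intro!: integrable_on_Icc continuous_intros)
    finally show ?thesis .
  qed
  show "spearman_footrule ?M = p * spearman_footrule C + q * spearman_footrule D"
    using one[of 2] assms(1,2) by (simp add: footrule_slice M slice algebra_simps)
  have "integral {-1..1} (slice ?M) = integral {-1..1} (\<lambda>h. p * slice C h + q * slice D h)"
    by (intro integral_cong) (rule slice)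
  also have "\<dots> = p * integral {-1..1} (slice C) + q * integral {-1..1} (slice D)"
    using assms(1,2)
    by (subst Henstock_Kurzweil_Integration.integral_add)
      (auto intro!: integrable_on_Icc continuous_intros continuous_slice)
  finally show "spearman_rho ?M = p * spearman_rho C + q * spearman_rho D"
    using one[of 7] assms(1,2) by (simp add: rho_slice M algebra_simps)
qed

lemma coefficients_close:
  assumes C: "copula C" and D: "copula D"
    and close: "\<And>u v. u \<in> {0..1} \<Longrightarrow> v \<in> {0..1} \<Longrightarrow> \<bar>C u v - D u v\<bar> \<le> e"
  shows "\<bar>spearman_footrule C - spearman_footrule D\<bar> \<le> 6 * e"
    and "\<bar>spearman_rho C - spearman_rho D\<bar> \<le> 24 * e"
proof -
  have le: "slice C h \<le> slice D h + e"
    if "copula C" "copula D" "\<And>u v. u \<in> {0..1} \<Longrightarrow> v \<in> {0..1} \<Longrightarrow> \<bar>C u v - D u v\<bar> \<le> e" for C D h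
  proof -
    have "slice C h \<le> integral {0..1} (\<lambda>t. plane_ext D t (t + h) + e)"
      unfolding slice_def
    proof (intro integral_le integrable_on_Icc continuous_intros that(1,2))
      fix t
      show "plane_ext C t (t + h) \<le> plane_ext D t (t + h) + e"
        using that(3)[of "clip t" "clip (t + h)"] clip_range by (simp add: plane_ext_def abs_le_iff)
    qed
    also have "\<dots> = slice D h + e"
      unfolding slice_def using integrable_plane_ext[OF that(2), of 0]
      by (subst Henstock_Kurzweil_Integration.integral_add) auto
    finally show ?thesis .
  qed
  have le1: "slice C h \<le> slice D h + e" and le2: "slice D h \<le> slice C h + e" for h
    using le[OF C D close] le[OF D C] close by (simp_all add: abs_minus_commute)
  show "\<bar>spearman_footrule C - spearman_footrule D\<bar> \<le> 6 * e"
    using le1[of 0] le2[of 0] unfolding footrule_slice[OF C] footrule_slice[OF D] abs_le_iff by linarith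
  have int: "integral {-1..1} (slice C) \<le> integral {-1..1} (slice D) + 2 * e"
    if "copula C" "copula D" "\<And>h. slice C h \<le> slice D h + e" for C D
  proof -
    have "integral {-1..1} (slice C) \<le> integral {-1..1} (\<lambda>h. slice D h + e)"
      by (intro integral_le integrable_on_Icc continuous_intros continuous_slice that)
    also have "\<dots> = integral {-1..1} (slice D) + 2 * e"
      using integrable_on_Icc[OF continuous_slice[OF that(2)]]
      by (subst Henstock_Kurzweil_Integration.integral_add) auto
    finally show ?thesis .
  qed
  show "\<bar>spearman_rho C - spearman_rho D\<bar> \<le> 24 * e"
    using int[OF C D le1] int[OF D C le2] unfolding rho_slice[OF C] rho_slice[OF D] abs_le_iff by linarith
qed

lemma copula_limit:
  assumes C: "\<And>n. copula (C n)"
    and lim: "\<And>u v. u \<in> {0..1} \<Longrightarrow> v \<in> {0..1} \<Longrightarrow> (\<lambda>n. C n u v) \<longlonglongrightarrow> D u v"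
  shows "copula D"
  unfolding copula_def
proof (intro conjI ballI allI impI)
  fix u v :: real assume uv: "u \<in> {0..1}" "v \<in> {0..1}"
  have "0 \<le> C n u v" "C n u v \<le> 1" for n
    using C[of n] uv unfolding copula_def by auto
  then show "D u v \<in> {0..1}"
    using LIMSEQ_le_const[OF lim[OF uv]] LIMSEQ_le_const2[OF lim[OF uv]] by auto
next
  fix u1 u2 v1 v2 :: real
  assume le: "0 \<le> u1 \<and> u1 \<le> u2 \<and> u2 \<le> 1 \<and> 0 \<le> v1 \<and> v1 \<le> v2 \<and> v2 \<le> 1"
  then have "(\<lambda>n. C n u2 v2 - C n u2 v1 - C n u1 v2 + C n u1 v1) \<longlonglongrightarrow> D u2 v2 - D u2 v1 - D u1 v2 + D u1 v1"
    by (intro tendsto_intros lim) auto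
  moreover have "0 \<le> C n u2 v2 - C n u2 v1 - C n u1 v2 + C n u1 v1" for n
    using C[of n] le unfolding copula_def by blast
  ultimately show "D u2 v2 - D u2 v1 - D u1 v2 + D u1 v1 \<ge> 0"
    using LIMSEQ_le_const by blast
next
  fix u :: real assume u: "u \<in> {0..1}"
  then have "C n 0 u = 0" "C n u 0 = 0" "C n u 1 = u" "C n 1 u = u" for n
    using C[of n] unfolding copula_def by auto
  then show "D 0 u = 0" "D u 0 = 0" "D u 1 = u" "D 1 u = u"
    using lim[of 0 u] lim[of u 0] lim[of u 1] lim[of 1 u] u
    by (auto simp: LIMSEQ_const_iff)
qed

text \<open>
  Copulas are \<open>1\<close>-Lipschitz in each variable, so a sequence of copulas has a uniformly convergent
  subsequence; its limit is a copula, and both coefficients are continuous for uniform convergence.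
\<close>

lemma closed_rho_values: "closed {spearman_rho C | C. copula C \<and> spearman_footrule C = x}"
  unfolding closed_sequential_limits
proof (intro allI impI, elim conjE)
  fix y l assume y: "\<forall>n. y n \<in> {spearman_rho C | C. copula C \<and> spearman_footrule C = x}" and l: "y \<longlonglongrightarrow> l"
  from y have "\<exists>C. copula C \<and> spearman_footrule C = x \<and> y n = spearman_rho C" for n by blast
  then obtain C where C: "\<And>n. copula (C n)" "\<And>n. spearman_footrule (C n) = x" "\<And>n. y n = spearman_rho (C n)"
    by metis
  let ?S = "{0..1} \<times> {0..1} :: (real \<times> real) set"
  obtain g and k :: "nat \<Rightarrow> nat" where k: "strict_mono k"
    and g: "\<And>e. 0 < e \<Longrightarrow> \<exists>N. \<forall>n z. n \<ge> N \<and> z \<in> ?S \<longrightarrow> norm (plane_ext (C (k n)) (fst z) (snd z) - g z) < e"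
  proof (rule Arzela_Ascoli[of ?S "\<lambda>n z. plane_ext (C n) (fst z) (snd z)" 1])
    show "compact ?S" by (intro compact_Times compact_Icc)
    show "norm (plane_ext (C n) (fst z) (snd z)) \<le> 1" for n z
      using plane_ext_bounds(1,3)[OF C(1), of n "fst z" "snd z"] clip_range(2)[of "fst z"] by simp
    show "\<exists>d>0. \<forall>n z'. z' \<in> ?S \<and> norm (z - z') < d \<longrightarrow>
        norm (plane_ext (C n) (fst z) (snd z) - plane_ext (C n) (fst z') (snd z')) < e" if "0 < e" for z e
    proof (intro exI[of _ "e/2"] conjI allI impI)
      fix n and z' :: "real \<times> real" assume z': "z' \<in> ?S \<and> norm (z - z') < e/2"
      have "\<bar>fst z - fst z'\<bar> \<le> norm (z - z')" "\<bar>snd z - snd z'\<bar> \<le> norm (z - z')"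
        using dist_fst_le[of z z'] dist_snd_le[of z z'] by (simp_all add: dist_norm)
      then show "norm (plane_ext (C n) (fst z) (snd z) - plane_ext (C n) (fst z') (snd z')) < e"
        using z' plane_ext_lipschitz[OF C(1), of n "fst z" "snd z" "fst z'" "snd z'"] by simp
    qed (use that in simp)
  qed blast
  define D where "D u v = g (u, v)" for u v
  have unif: "\<exists>N. \<forall>n\<ge>N. \<forall>u\<in>{0..1}. \<forall>v\<in>{0..1}. \<bar>C (k n) u v - D u v\<bar> < e" if e: "0 < e" for e
  proof -
    obtain N where "\<And>n z. n \<ge> N \<Longrightarrow> z \<in> ?S \<Longrightarrow> norm (plane_ext (C (k n)) (fst z) (snd z) - g z) < e"
      using g[OF e] by blast
    then have "\<bar>C (k n) u v - D u v\<bar> < e" if "n \<ge> N" "u \<in> {0..1}" "v \<in> {0..1}" for n u v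
      using that(1) that(2,3) by (force simp: D_def plane_ext_inside)
    then show ?thesis by blast
  qed
  have D: "copula D"
  proof (rule copula_limit[of "\<lambda>n. C (k n)"])
    show "(\<lambda>n. C (k n) u v) \<longlonglongrightarrow> D u v" if "u \<in> {0..1}" "v \<in> {0..1}" for u v
      by (rule LIMSEQ_I) (use unif that in fastforce)
  qed (rule C(1))
  have close: "\<exists>N. \<forall>n\<ge>N. \<bar>spearman_footrule (C (k n)) - spearman_footrule D\<bar> < e
      \<and> \<bar>spearman_rho (C (k n)) - spearman_rho D\<bar> < e" if e: "0 < e" for e
  proof -
    \<comment> \<open>any denominator above the constant \<open>24\<close> of \<open>coefficients_close\<close> gives a strict inequality\<close>
    obtain N where N: "\<forall>n\<ge>N. \<forall>u\<in>{0..1}. \<forall>v\<in>{0..1}. \<bar>C (k n) u v - D u v\<bar> < e/25"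
      using unif[of "e/25"] e by auto
    have "\<bar>spearman_footrule (C (k n)) - spearman_footrule D\<bar> < e \<and> \<bar>spearman_rho (C (k n)) - spearman_rho D\<bar> < e"
      if "n \<ge> N" for n
      using coefficients_close[OF C(1) D, of "k n" "e/25"] N that \<open>0 < e\<close> by fastforce
    then show ?thesis by blast
  qed
  have "(\<lambda>n. spearman_rho (C (k n))) \<longlonglongrightarrow> spearman_rho D"
    by (rule LIMSEQ_I) (use close in fastforce)
  moreover have "(\<lambda>n. spearman_rho (C (k n))) \<longlonglongrightarrow> l"
    using LIMSEQ_subseq_LIMSEQ[OF l k] by (simp add: o_def C(3))
  ultimately have "l = spearman_rho D" by (rule LIMSEQ_unique[symmetric])
  moreover have "(\<lambda>n. spearman_footrule (C (k n))) \<longlonglongrightarrow> spearman_footrule D"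
    by (rule LIMSEQ_I) (use close in fastforce)
  then have "spearman_footrule D = x" by (simp add: C(2) LIMSEQ_const_iff)
  ultimately show "l \<in> {spearman_rho C | C. copula C \<and> spearman_footrule C = x}"
    using D by blast
qed

section \<open>The exact region\<close>

lemma powr_three_halves:
  fixes a :: real assumes "0 \<le> a"
  shows "(3 * a\<^sup>2) powr (3/2) = 3 * sqrt 3 * a^3"
proof (cases "a = 0")
  case False
  have "(3 * a\<^sup>2) powr (3/2) = (3 * a\<^sup>2) powr (1 + 1/2)" by simp
  also have "\<dots> = (3 * a\<^sup>2) * sqrt (3 * a\<^sup>2)"
    using False by (subst powr_add) (simp add: powr_half_sqrt)
  also have "\<dots> = 3 * sqrt 3 * a^3"
    using assms by (simp add: real_sqrt_mult power3_eq_cube power2_eq_square)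
  finally show ?thesis .
qed simp

text \<open>
  With \<open>1 + 2 * x = 3 * a\<^sup>2\<close> both curves become polynomials in \<open>a\<close>, and \<open>x = -1/8\<close> corresponds to
  \<open>a = 1/2\<close>.
\<close>

lemma footrule_parameter:
  fixes x :: real
  assumes "x \<in> {-1/2..1}"
  obtains a where "0 \<le> a" "a \<le> 1" "x = (3 * a\<^sup>2 - 1) / 2"
    "2/9 * sqrt 3 * (1 + 2 * x) powr (3/2) - 1 = 2 * a^3 - 1"
    "x \<le> -1/8 \<Longrightarrow> a \<le> 1/2 \<and> r_lower x = 3 * a\<^sup>2 - 1/2 - a^3"
proof -
  define a where "a = sqrt ((1 + 2 * x) / 3)"
  have a: "0 \<le> a" "a \<le> 1" using assms by (auto simp: a_def)
  have x: "1 + 2 * x = 3 * a\<^sup>2" using assms by (simp add: a_def)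
  then have x': "x = (3 * a\<^sup>2 - 1) / 2" by simp
  have s: "sqrt 3 * (3 * sqrt 3 * y) = 9 * y" for y :: real
    by simp
  have 1: "2/9 * sqrt 3 * (1 + 2 * x) powr (3/2) - 1 = 2 * a^3 - 1"
    unfolding x powr_three_halves[OF a(1)] mult.assoc[of "2/9"] s by simp
  have 2: "a \<le> 1/2 \<and> r_lower x = 3 * a\<^sup>2 - 1/2 - a^3" if "x \<le> -1/8"
  proof
    have "a\<^sup>2 \<le> (1/2)\<^sup>2" using x that by (simp add: power_divide)
    then show "a \<le> 1/2" by (rule power2_le_imp_le) simp
    have "r_lower x = 2 * x + 1/2 - sqrt 3 / 9 * (1 + 2 * x) powr (3/2)"
      using that assms by (intro r_lower_pieces) auto
    also have "\<dots> = 3 * a\<^sup>2 - 1/2 - a^3"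
      unfolding x powr_three_halves[OF a(1)] times_divide_eq_left s using x by simp
    finally show "r_lower x = 3 * a\<^sup>2 - 1/2 - a^3" .
  qed
  from that[OF a x' 1 2] show ?thesis .
qed

definition max_rho :: "real \<Rightarrow> real" where
  "max_rho x = Sup {spearman_rho C | C. copula C \<and> spearman_footrule C = x}"

lemma bdd_above_rho_values: "bdd_above {spearman_rho C | C. copula C \<and> spearman_footrule C = x}"
  using rho_upper by (intro bdd_aboveI[of _ "1 - 2/3 * (1 - x)\<^sup>2"]) auto

lemma rho_le_max_rho: "copula C \<Longrightarrow> spearman_rho C \<le> max_rho (spearman_footrule C)"
  unfolding max_rho_def by (intro cSup_upper bdd_above_rho_values) auto

text \<open>
  A closed, bounded and nonempty set of reals contains its supremum; nonemptiness comes from the copulas on the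
  lower curve.
\<close>

lemma max_rho_attained:
  assumes "x \<in> {-1/2..1}"
  obtains C where "copula C" "spearman_footrule C = x" "spearman_rho C = max_rho x"
proof -
  obtain a where a: "0 \<le> a" "a \<le> 1" "x = (3 * a\<^sup>2 - 1) / 2"
    using footrule_parameter[OF assms] by metis
  obtain C where "copula C" "spearman_footrule C = x"
    using lower_boundary_attained[OF a(1,2)] a(3) by metis
  then have "{spearman_rho C | C. copula C \<and> spearman_footrule C = x} \<noteq> {}" by blast
  then have "max_rho x \<in> {spearman_rho C | C. copula C \<and> spearman_footrule C = x}"
    unfolding max_rho_def by (intro closed_contains_Sup bdd_above_rho_values closed_rho_values)
  with that show ?thesis by force
qed

lemma concave_max_rho: "concave_on {-1/2..1} max_rho"
  unfolding concave_on_iff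
proof (intro conjI ballI allI impI)
  fix x y u v :: real
  assume xy: "x \<in> {-1/2..1}" "y \<in> {-1/2..1}" and uv: "0 \<le> u" "0 \<le> v" "u + v = 1"
  obtain C where C: "copula C" "spearman_footrule C = x" "spearman_rho C = max_rho x"
    using max_rho_attained[OF xy(1)] .
  obtain D where D: "copula D" "spearman_footrule D = y" "spearman_rho D = max_rho y"
    using max_rho_attained[OF xy(2)] .
  show "u * max_rho x + v * max_rho y \<le> max_rho (u *\<^sub>R x + v *\<^sub>R y)"
    using rho_le_max_rho[OF copula_mix(1)[OF C(1) D(1) uv]] copula_mix(2,3)[OF C(1) D(1) uv] C D
    by simp
qed simp

lemma concave_above_chord:
  fixes s :: "real \<Rightarrow> real"
  assumes s: "concave_on A s" and pq: "p \<in> A" "q \<in> A" "p < q" and x: "p \<le> x" "x \<le> q"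
    and ends: "m * p + b \<le> s p" "m * q + b \<le> s q"
  shows "m * x + b \<le> s x"
proof -
  define t where "t = (x - p) / (q - p)"
  have t: "0 \<le> t" "t \<le> 1" using pq x by (auto simp: t_def)
  have xt: "x = (1 - t) * p + t * q"
    using pq(3) by (simp add: t_def divide_simps) (simp add: algebra_simps)
  have "m * x + b = (1 - t) * (m * p + b) + t * (m * q + b)"
    unfolding xt by (simp add: algebra_simps)
  also have "\<dots> \<le> (1 - t) * s p + t * s q"
    using t ends by (intro add_mono mult_left_mono) auto
  also have "\<dots> \<le> s ((1 - t) * p + t * q)"
    using concave_onD[OF s t pq(1,2)] by simp
  finally show ?thesis by (simp add: xt)
qed

lemma max_rho_left_curve:
  assumes x: "x \<in> {-1/2..-1/8}"
  shows "r_lower x \<le> max_rho x"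
proof -
  have "x \<in> {-1/2..1}" using x by auto
  then obtain a where a: "0 \<le> a" "x = (3 * a\<^sup>2 - 1) / 2"
    and "x \<le> -1/8 \<Longrightarrow> a \<le> 1/2 \<and> r_lower x = 3 * a\<^sup>2 - 1/2 - a^3"
    using footrule_parameter[of x thesis] by blast
  with x have a': "a \<le> 1/2" "r_lower x = 3 * a\<^sup>2 - 1/2 - a^3" by auto
  obtain C where C: "copula C" "spearman_footrule C = (3 * a\<^sup>2 - 1) / 2" "3 * a\<^sup>2 - 1/2 - a^3 \<le> spearman_rho C"
    using left_curve_attained[OF a(1) a'(1)] .
  have "r_lower x \<le> spearman_rho C" using C(3) a'(2) by simp
  also have "\<dots> \<le> max_rho x" using rho_le_max_rho[OF C(1)] unfolding C(2) a(2) .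
  finally show ?thesis .
qed

lemma max_rho_touching:
  assumes "1 \<le> n"
  shows "1 - 3 / (2 * (real n)\<^sup>2) \<le> max_rho (1 - 3 / (2 * real n))"
proof -
  obtain C where C: "copula C" "spearman_footrule C = 1 - 3 / (2 * real n)"
    "1 - 3 / (2 * (real n)\<^sup>2) \<le> spearman_rho C"
    using touching_point_attained[OF assms] .
  show ?thesis using C(3) rho_le_max_rho[OF C(1)] unfolding C(2) by (rule order_trans)
qed

text \<open>
  Each affine piece joins two points below the graph of \<open>max_rho\<close>: the end \<open>x = -1/8\<close> of the curved part and
  the touching points \<open>1 - 3/(2n)\<close>, beginning with \<open>1/4\<close>.
\<close>

lemma r_lower_le_max_rho:
  assumes x: "x \<in> {-1/2..1}"
  shows "r_lower x \<le> max_rho x"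
proof -
  consider "x \<le> -1/8" | "-1/8 \<le> x" "x \<le> 1/4" | "1/4 \<le> x" "x < 1" | "x = 1"
    using x by fastforce
  then show ?thesis
  proof cases
    case 1
    then show ?thesis using max_rho_left_curve x by auto
  next
    case 2
    have "4/3 * (-1/8) + 7/24 \<le> max_rho (-1/8)"
      using max_rho_left_curve[of "-1/8"] r_lower_pieces(2)[of "-1/8"] by simp
    moreover have "4/3 * (1/4) + 7/24 \<le> max_rho (1/4)"
      using max_rho_touching[of 2] by simp
    ultimately have "4/3 * x + 7/24 \<le> max_rho x"
      using 2 by - (rule concave_above_chord[OF concave_max_rho, of "-1/8" "1/4"]; auto)
    then show ?thesis using r_lower_pieces(2)[of x] 2 by simp
  next
    case 3
    then obtain n where n: "2 \<le> n" "x \<in> r_segment n" using r_segment_exists by blast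
    let ?p = "1 - 3 / (2 * real n)" and ?q = "1 - 3 / (2 * (real n + 1))"
    let ?m = "(2 * real n + 1) / (real n ^ 2 + real n)"
    let ?b = "(2 * real n ^ 2 - 2 * real n + 1) / (2 * (real n ^ 2 + real n))"
    have pos: "real n \<ge> 2" using n by simp
    have chord: "(2 * y + 1) / (y^2 + y) * (1 - 3 / (2 * y)) + (2 * y^2 - 2 * y + 1) / (2 * (y^2 + y)) = 1 - 3 / (2 * y\<^sup>2)"
      "(2 * y + 1) / (y^2 + y) * (1 - 3 / (2 * (y + 1))) + (2 * y^2 - 2 * y + 1) / (2 * (y^2 + y)) = 1 - 3 / (2 * (y + 1)\<^sup>2)"
      if "2 \<le> y" for y :: real
    proof -
      have y: "y^2 + y = y * (y + 1)" by (simp add: power2_eq_square algebra_simps)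
      have nz: "y \<noteq> 0" "y + 1 \<noteq> 0" using that by auto
      show "(2 * y + 1) / (y^2 + y) * (1 - 3 / (2 * y)) + (2 * y^2 - 2 * y + 1) / (2 * (y^2 + y)) = 1 - 3 / (2 * y\<^sup>2)"
        "(2 * y + 1) / (y^2 + y) * (1 - 3 / (2 * (y + 1))) + (2 * y^2 - 2 * y + 1) / (2 * (y^2 + y)) = 1 - 3 / (2 * (y + 1)\<^sup>2)"
        unfolding y using nz by (simp_all add: divide_simps) (simp_all add: algebra_simps power2_eq_square)
    qed
    have "?m * ?p + ?b \<le> max_rho ?p"
      unfolding chord(1)[OF pos] using n by (intro max_rho_touching) simp
    moreover have "?m * ?q + ?b \<le> max_rho ?q"
      unfolding chord(2)[OF pos] using max_rho_touching[of "n + 1"] by (simp only: of_nat_add of_nat_1)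
    moreover have "?p < ?q" "-1/2 \<le> ?p" "?q \<le> 1" using pos by (auto simp: field_simps)
    moreover have "?p \<le> x" "x \<le> ?q" using n(2) by (auto simp: r_segment_def)
    ultimately have "?m * x + ?b \<le> max_rho x"
      by - (rule concave_above_chord[OF concave_max_rho, of ?p ?q]; auto)
    moreover have "r_lower x = ?m * x + ?b"
      using r_lower_pieces(3)[OF n(1)] n(2) by (simp add: r_segment_def)
    ultimately show ?thesis by simp
  next
    case 4
    obtain C where "copula C" "spearman_footrule C = 1" "spearman_rho C = 1"
      using lower_boundary_attained[of 1] by auto
    then show ?thesis using rho_le_max_rho[of C] 4 r_lower_pieces(4) by simp
  qed
qed

theorem theorem15:
  shows "\<exists>s :: real \<Rightarrow> real.
    s \<in> {- 1/2 .. 1} \<rightarrow> {- 1 .. 1} \<and>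
    concave_on {- 1/2 .. 1} s \<and>
    (\<forall>x\<in>{- 1/2 .. 1}. r_lower x \<le> s x \<and> s x \<le> 1 - 2/3 * (1 - x) ^ 2) \<and>
    {(spearman_footrule C, spearman_rho C) | C. copula C} =
      {(x, y). x \<in> {- 1/2 .. 1} \<and> 2/9 * sqrt 3 * (1 + 2 * x) powr (3/2) - 1 \<le> y \<and> y \<le> s x}"
proof (intro exI[of _ max_rho] conjI ballI)
  let ?l = "\<lambda>x. 2/9 * sqrt 3 * (1 + 2 * x) powr (3/2) - 1 :: real"
  have lower: "?l (spearman_footrule C) \<le> spearman_rho C" if C: "copula C" for C
  proof -
    obtain a where "0 \<le> a" "spearman_footrule C = (3 * a\<^sup>2 - 1) / 2" "?l (spearman_footrule C) = 2 * a^3 - 1"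
      using footrule_parameter[OF footrule_range[OF C]] by metis
    then show ?thesis using rho_lower_param[OF C] by metis
  qed
  have upper: "max_rho x \<le> 1 - 2/3 * (1 - x)\<^sup>2" if "x \<in> {-1/2..1}" for x
    using max_rho_attained[OF that] rho_upper by metis
  show "concave_on {-1/2..1} max_rho" by (rule concave_max_rho)
  show "r_lower x \<le> max_rho x" "max_rho x \<le> 1 - 2/3 * (1 - x)\<^sup>2" if "x \<in> {-1/2..1}" for x
    using r_lower_le_max_rho[OF that] upper[OF that] .
  show "max_rho \<in> {-1/2..1} \<rightarrow> {-1..1}"
  proof
    fix x :: real assume x: "x \<in> {-1/2..1}"
    obtain C where C: "copula C" "spearman_footrule C = x" "spearman_rho C = max_rho x"
      using max_rho_attained[OF x] .
    have "0 \<le> 2/9 * sqrt 3 * (1 + 2 * x) powr (3/2)" by simp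
    then have "-1 \<le> max_rho x" using lower[OF C(1)] unfolding C(2,3) by linarith
    moreover have "max_rho x \<le> 1" using upper[OF x] zero_le_power2[of "1 - x"] by linarith
    ultimately show "max_rho x \<in> {-1..1}" by simp
  qed
  show "{(spearman_footrule C, spearman_rho C) | C. copula C} =
      {(x, y). x \<in> {- 1/2 .. 1} \<and> ?l x \<le> y \<and> y \<le> max_rho x}" (is "?A = ?B")
  proof (intro equalityI subsetI)
    fix z assume "z \<in> ?A"
    then show "z \<in> ?B" using lower footrule_range rho_le_max_rho by auto
  next
    fix z assume "z \<in> ?B"
    then obtain x y where z: "z = (x, y)" and x: "x \<in> {-1/2..1}" and y: "?l x \<le> y" "y \<le> max_rho x"
      by auto
    obtain a where a: "0 \<le> a" "a \<le> 1" "x = (3 * a\<^sup>2 - 1) / 2" "?l x = 2 * a^3 - 1"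
      using footrule_parameter[OF x] by metis
    obtain C where C: "copula C" "spearman_footrule C = x" "spearman_rho C = ?l x"
      using lower_boundary_attained[OF a(1,2)] a(3,4) by metis
    obtain D where D: "copula D" "spearman_footrule D = x" "spearman_rho D = max_rho x"
      using max_rho_attained[OF x] .
    from y have "y \<in> closed_segment (?l x) (max_rho x)"
      by (simp add: closed_segment_eq_real_ivl)
    then obtain t where t: "0 \<le> t" "t \<le> 1" "y = (1 - t) * ?l x + t * max_rho x"
      by (auto simp: in_segment)
    let ?M = "\<lambda>u v. (1 - t) * C u v + t * D u v"
    have "copula ?M" "spearman_footrule ?M = x" "spearman_rho ?M = y"
      using copula_mix[OF C(1) D(1), of "1 - t" t] t C D by (simp_all add: algebra_simps)
    then show "z \<in> ?A" using z by blast
  qed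
qed

end
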